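(* Let $d\ge2$, $s\in\mathbb N$, $\beta>-d-s$, and $\lambda_0,\dots,\lambda_{s-1}>0$. The polynomials $\mathsf S_{m,\ell}^{n,(\beta,-s)}$, $n\in\mathbb N_0$, $0\le m\le n$, $1\le\ell\le\dim\mathcal H_m^d$, are mutually orthogonal with respect to $\langle\cdot,\cdot\rangle_{\beta,-s}$, i.e. $\langle \mathsf S_{m,\ell}^{n,(\beta,-s)},\mathsf S_{m',\ell'}^{n',(\beta,-s)}\rangle_{\beta,-s}=0$ unless $(n,m,\ell)=(n',m',\ell')$; and for every $\ell$, $$\mathsf h_{m,n}^{(\beta,-s)}:=\langle \mathsf S_{m,\ell}^{n,(\beta,-s)},\mathsf S_{m,\ell}^{n,(\beta,-s)}\rangle_{\beta,-s}=\begin{cases}2^{2(n-m)}\lambda_{n-m},&0\le n-m\le s-1,\\[2pt] 2^{\,s-\beta-2m-d}\,\widehat h_{n-m-s}^{(s+2m+\beta+d-1,0)},& n-m\ge s.\end{cases}$$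
   Context: The conic surface is $\mathbb V_0^{d+1}=\{(x,t)\in\mathbb R^d\times\mathbb R:\|x\|=t,\ 0\le t\le1\}$; its points are written $(x,t)=(t\xi,t)$, $\xi\in\mathbb S^{d-1}$. $\mathrm d\mathsf m$ is its surface measure, with $\int_{\mathbb V_0^{d+1}}f\,\mathrm d\mathsf m=\int_0^1t^{d-1}\int_{\mathbb S^{d-1}}f(t\xi,t)\,\mathrm d\sigma(\xi)\,\mathrm dt$; $\sigma$ is surface measure on $\mathbb S^{d-1}$ and $\omega_d=2\pi^{d/2}/\Gamma(d/2)$. $\mathcal H_m^d$ is the space of spherical harmonics of degree $m$ on $\mathbb S^{d-1}$ and $\{Y_\ell^m:1\le\ell\le\dim\mathcal H_m^d\}$ an orthonormal basis for $\frac1{\omega_d}\int_{\mathbb S^{d-1}}fg\,\mathrm d\sigma$; $Y_\ell^m$ also denotes its extension to a homogeneous harmonic polynomial on $\mathbb R^d$ (so $Y_\ell^m(t\xi)=t^mY_\ell^m(\xi)$). Pochhammer $(a)_k=a(a+1)\cdots(a+k-1)$. Jacobi polynomials for real parameters: $P_n^{(\alpha,\beta)}(u)=\sum_{k=0}^n\frac{(\alpha+k+1)_{n-k}(-n)_k(n+\alpha+\beta+1)_k}{n!\,k!}(\frac{1-u}{2})^k$. $A_n^{(\alpha,\beta)}=2^n/(n+\alpha+\beta+1)_n$, $\widehat P_n^{(\alpha,\beta)}=A_n^{(\alpha,\beta)}P_n^{(\alpha,\beta)}$, and for $\alpha,\beta>-1$, $\widehat h_n^{(\alpha,\beta)}=\int_{-1}^1[\widehat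 P_n^{(\alpha,\beta)}(u)]^2(1-u)^\alpha(1+u)^\beta\,\mathrm du$. For $\alpha>-1-s$: $J_n^{(\alpha,-s)}(u)=\frac{(u+1)^n}{n!}$ if $0\le n\le s-1$, and $J_n^{(\alpha,-s)}(u)=\int_{-1}^u\frac{(u-w)^{s-1}}{(s-1)!}\widehat P_{n-s}^{(\alpha+s,0)}(w)\,\mathrm dw$ if $n\ge s$. Sobolev orthogonal polynomials: $\mathsf S_{m,\ell}^{n,(\beta,-s)}(x,t)=J_{n-m}^{(2m+\beta+d-1,-s)}(1-2t)\,Y_\ell^m(x)$, a polynomial in $(x,t)\in\mathbb R^{d+1}$. Sobolev inner product (for functions $f,g$ of $(x,t)\in\mathbb R^{d+1}$ for which it is finite, e.g. polynomials), with $\partial_t=\partial/\partial t$ the partial derivative in the last variable with $x$ held fixed: $\langle f,g\rangle_{\beta,-s}=\frac1{\omega_d}\int_{\mathbb V_0^{d+1}}\partial_t^sf(x,t)\,\partial_t^sg(x,t)\,t^{\beta+s}\,\mathrm d\mathsf m(x,t)+\sum_{k=0}^{s-1}\frac{\lambda_k}{\omega_d}\int_{\mathbb S^{d-1}}\partial_t^kf(\xi,1)\,\partial_t^kg(\xi,1)\,\mathrm d\sigma(\xi)$. *)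

theory Defs
  imports "HOL-Analysis.Analysis"
begin

inductive polyfun :: "(real^'d::finite \<Rightarrow> real) \<Rightarrow> bool" where
  pf_const: "polyfun (\<lambda>x. c)"
| pf_coord: "polyfun (\<lambda>x. x $ i)"
| pf_add: "polyfun f \<Longrightarrow> polyfun g \<Longrightarrow> polyfun (\<lambda>x. f x + g x)"
| pf_mult: "polyfun f \<Longrightarrow> polyfun g \<Longrightarrow> polyfun (\<lambda>x. f x * g x)"

definition laplacian :: "(real^'d::finite \<Rightarrow> real) \<Rightarrow> real^'d \<Rightarrow> real" where
  "laplacian f x = (\<Sum>i\<in>UNIV. deriv (deriv (\<lambda>u. f (x + u *\<^sub>R axis i 1))) 0)"

text \<open>Homogeneous harmonic polynomials of degree m (extensions of spherical harmonics in H_m^d).\<close>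
definition sph_harm :: "nat \<Rightarrow> (real^'d::finite \<Rightarrow> real) set" where
  "sph_harm m = {Y. polyfun Y \<and> (\<forall>t x. Y (t *\<^sub>R x) = t ^ m * Y x) \<and> (\<forall>x. laplacian Y x = 0)}"

text \<open>Surface measure on the unit sphere S^{d-1} (cone-measure construction:
  sigma(A) = d * Lebesgue measure of {r xi : 0 < r < 1, xi in A}).\<close>
definition sph_meas :: "(real^'d::finite) measure" where
  "sph_meas = scale_measure (of_nat CARD('d))
     (distr (restrict_space lborel (ball 0 1 - {0})) borel (\<lambda>x. x /\<^sub>R norm x))"

definition sph_int :: "(real^'d::finite \<Rightarrow> real) \<Rightarrow> real" where
  "sph_int f = integral\<^sup>L sph_meas f"

definition omega :: "nat \<Rightarrow> real" where
  "omega d = 2 * pi powr (real d / 2) / Gamma (real d / 2)"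

definition dt :: "nat \<Rightarrow> (real^'d::finite \<Rightarrow> real \<Rightarrow> real) \<Rightarrow> real^'d \<Rightarrow> real \<Rightarrow> real" where
  "dt k f x t = (deriv ^^ k) (\<lambda>\<tau>. f x \<tau>) t"

definition cone_int :: "(real^'d::finite \<Rightarrow> real \<Rightarrow> real) \<Rightarrow> real" where
  "cone_int F = (LBINT t=0..1. t ^ (CARD('d) - 1) * sph_int (\<lambda>\<xi>. F (t *\<^sub>R \<xi>) t))"

definition sob_ip :: "real \<Rightarrow> nat \<Rightarrow> (nat \<Rightarrow> real) \<Rightarrow> (real^'d::finite \<Rightarrow> real \<Rightarrow> real)
    \<Rightarrow> (real^'d \<Rightarrow> real \<Rightarrow> real) \<Rightarrow> real" where
  "sob_ip \<beta> s lam f g =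
     1 / omega CARD('d) * cone_int (\<lambda>x t. dt s f x t * dt s g x t * t powr (\<beta> + real s))
   + (\<Sum>k<s. lam k / omega CARD('d) * sph_int (\<lambda>\<xi>. dt k f \<xi> 1 * dt k g \<xi> 1))"

definition jacobiP :: "nat \<Rightarrow> real \<Rightarrow> real \<Rightarrow> real \<Rightarrow> real" where
  "jacobiP n a b u = (\<Sum>k=0..n. pochhammer (a + real k + 1) (n - k) * pochhammer (- real n) k
       * pochhammer (real n + a + b + 1) k / (fact n * fact k) * ((1 - u) / 2) ^ k)"

definition jacobiA :: "nat \<Rightarrow> real \<Rightarrow> real \<Rightarrow> real" where
  "jacobiA n a b = 2 ^ n / pochhammer (real n + a + b + 1) n"

definition jacobiPhat :: "nat \<Rightarrow> real \<Rightarrow> real \<Rightarrow> real \<Rightarrow> real" where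
  "jacobiPhat n a b u = jacobiA n a b * jacobiP n a b u"

definition jacobi_hhat :: "nat \<Rightarrow> real \<Rightarrow> real \<Rightarrow> real" where
  "jacobi_hhat n a b = (LBINT u=-1..1. (jacobiPhat n a b u)\<^sup>2 * (1 - u) powr a * (1 + u) powr b)"

definition jacobiJ :: "nat \<Rightarrow> real \<Rightarrow> nat \<Rightarrow> real \<Rightarrow> real" where
  "jacobiJ n a s u = (if n \<le> s - 1 then (u + 1) ^ n / fact n
     else (LBINT w=-1..u. (u - w) ^ (s - 1) / fact (s - 1) * jacobiPhat (n - s) (a + real s) 0 w))"

definition sobS :: "real \<Rightarrow> nat \<Rightarrow> nat \<Rightarrow> nat \<Rightarrow> (real^'d::finite \<Rightarrow> real) \<Rightarrow> real^'d \<Rightarrow> real \<Rightarrow> real" where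
  "sobS \<beta> s n m Y x t = jacobiJ (n - m) (2 * real m + \<beta> + real CARD('d) - 1) s (1 - 2 * t) * Y x"

end

theory Submission
  imports Defs "HOL-Computational_Algebra.Polynomial"
begin

text \<open>
  On products of a polynomial in \<open>t\<close> with homogeneous polynomials of degrees \<open>m\<close>, \<open>m'\<close> in \<open>x\<close>, the
  Sobolev inner product factors into the spherical inner product and a one-dimensional bracket.
  The bracket is diagonal because the \<open>s\<close>-th derivative of \<open>J\<^sub>n\<close> is \<open>0\<close> or a monic Jacobi polynomial,
  while its lower derivatives at \<open>-1\<close> are Kronecker deltas or vanish.
  Spherical harmonics of different degrees are orthogonal because the surface measure is
  invariant under rotations: the generators \<open>x\<^sub>i \<partial>\<^sub>j - x\<^sub>j \<partial>\<^sub>i\<close> have mean zero, which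
  expresses \<open>\<integral> \<nabla>Y \<bullet> \<nabla>Z\<close> as \<open>(d + m + k - 2) m \<integral> Y Z\<close>, and the left side is symmetric in \<open>Y\<close>, \<open>Z\<close>.
\<close>

section \<open>Rotation invariance of the surface measure\<close>

lemma nn_integral_lborel_translate:
  fixes f :: "'a::euclidean_space \<Rightarrow> ennreal"
  assumes [measurable]: "f \<in> borel_measurable borel"
  shows "(\<integral>\<^sup>+x. f (c + x) \<partial>lborel) = (\<integral>\<^sup>+x. f x \<partial>lborel)"
proof -
  have "(\<integral>\<^sup>+x. f x \<partial>lborel) = (\<integral>\<^sup>+x. f x \<partial>distr lborel borel ((+) c))"
    by (simp only: lborel_distr_plus)
  also have "\<dots> = (\<integral>\<^sup>+x. f (c + x) \<partial>lborel)"
    by (subst nn_integral_distr) auto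
  finally show ?thesis ..
qed

text \<open>
  Uniqueness of Haar measure, specialised: apply Fubini to \<open>1\<^sub>A (T x) 1\<^sub>B (y - T x)\<close> with \<open>B\<close> the unit
  ball, whose measure is preserved by \<open>T\<close>.
\<close>
lemma lborel_distr_orthogonal:
  fixes T :: "'a::euclidean_space \<Rightarrow> 'a"
  assumes T: "orthogonal_transformation T"
  shows "distr lborel borel T = lborel"
proof (rule measure_eqI)
  have lin: "linear T" using T by (rule orthogonal_transformation_linear)
  have T_meas [measurable]: "T \<in> borel_measurable borel"
    by (intro borel_measurable_continuous_onI linear_continuous_on) (simp add: lin linear_conv_bounded_linear[symmetric])
  define S where "S = inv T"
  have TS: "T (S y) = y" for y
    using T unfolding S_def by (simp add: orthogonal_transformation_surj surj_f_inv_f)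
  have S_meas [measurable]: "S \<in> borel_measurable borel"
    unfolding S_def
    by (intro borel_measurable_continuous_onI linear_continuous_on)
       (simp add: linear_conv_bounded_linear[symmetric] orthogonal_transformation_linear orthogonal_transformation_inv T)
  define b :: "'a \<Rightarrow> ennreal" where "b = indicator (ball 0 1)"
  have b_meas [measurable]: "b \<in> borel_measurable borel" unfolding b_def by (rule borel_measurable_indicator) simp
  have b_minus: "b (- x) = b x" for x by (auto simp: b_def indicator_def)
  have b_T: "b (T x) = b x" for x using T by (auto simp: b_def indicator_def orthogonal_transformation_norm)
  have Ib: "(\<integral>\<^sup>+x. b x \<partial>lborel) = emeasure lborel (ball (0::'a) 1)" unfolding b_def by simp
  fix A assume "A \<in> sets (distr lborel borel T)"
  then have A [measurable]: "A \<in> sets borel" by simp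
  define a :: "'a \<Rightarrow> ennreal" where "a = indicator A"
  have a_meas [measurable]: "a \<in> borel_measurable borel" unfolding a_def by measurable
  have Ia: "(\<integral>\<^sup>+x. a x \<partial>lborel) = emeasure lborel A" unfolding a_def by simp
  have "(\<integral>\<^sup>+x. a (T x) \<partial>lborel) * (\<integral>\<^sup>+y. b y \<partial>lborel) = (\<integral>\<^sup>+x. a (T x) * (\<integral>\<^sup>+y. b y \<partial>lborel) \<partial>lborel)"
    by (simp add: nn_integral_multc)
  also have "\<dots> = (\<integral>\<^sup>+x. (\<integral>\<^sup>+y. a (T x) * b (- T x + y) \<partial>lborel) \<partial>lborel)"
    by (simp add: nn_integral_cmult nn_integral_lborel_translate del: add_uminus_conv_diff uminus_add_conv_diff)
  also have "\<dots> = (\<integral>\<^sup>+y. (\<integral>\<^sup>+x. a (T x) * b (- T x + y) \<partial>lborel) \<partial>lborel)"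
    by (rule lborel_pair.Fubini'[symmetric]) measurable
  \<comment> \<open>For fixed \<open>y\<close> the inner variable is shifted by \<open>S y\<close>.
    As \<open>T (S y) = y\<close>, the argument of \<open>a\<close> becomes \<open>T x + y\<close>
    and that of \<open>b\<close> becomes \<open>- T x\<close>; evenness and
    \<open>T\<close>-invariance of the ball reduce the latter to \<open>x\<close>.\<close>
  also have "\<dots> = (\<integral>\<^sup>+y. (\<integral>\<^sup>+x. a (T (S y + x)) * b (- T (S y + x) + y) \<partial>lborel) \<partial>lborel)"
    by (intro nn_integral_cong nn_integral_lborel_translate[symmetric]) measurable
  also have "\<dots> = (\<integral>\<^sup>+y. (\<integral>\<^sup>+x. a (T x + y) * b x \<partial>lborel) \<partial>lborel)"
    using b_minus[of "T _"] by (simp add: linear_add[OF lin] TS b_T add.commute)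
  also have "\<dots> = (\<integral>\<^sup>+x. (\<integral>\<^sup>+y. a (T x + y) * b x \<partial>lborel) \<partial>lborel)"
    by (rule lborel_pair.Fubini') measurable
  also have "\<dots> = (\<integral>\<^sup>+y. a y \<partial>lborel) * (\<integral>\<^sup>+y. b y \<partial>lborel)"
    by (simp add: nn_integral_multc nn_integral_cmult nn_integral_lborel_translate)
  \<comment> \<open>The common factor is the volume of the unit ball, which is positive and finite
    and so may be cancelled in \<open>ennreal\<close>.\<close>
  finally have "(\<integral>\<^sup>+x. a (T x) \<partial>lborel) = (\<integral>\<^sup>+y. a y \<partial>lborel)"
    using content_ball_pos[of 1 "0::'a"] emeasure_bounded_finite[OF bounded_ball, of "0::'a" 1]
    by (auto simp: Ib ennreal_mult_cancel_left measure_def mult.commute[of _ "emeasure lborel (ball 0 1)"])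
  then have "emeasure lborel A = (\<integral>\<^sup>+x. a (T x) \<partial>lborel)" using Ia by simp
  also have "\<dots> = (\<integral>\<^sup>+x. indicator (T -` A) x \<partial>lborel)"
    by (simp add: a_def indicator_def)
  also have "\<dots> = emeasure lborel (T -` A)"
    using measurable_sets[OF T_meas A] by simp
  finally show "emeasure (distr lborel borel T) A = emeasure lborel A"
    by (simp add: emeasure_distr)
qed simp

text \<open>Turns questions about the surface into questions about volumes of cones, where
  invariance of Lebesgue measure applies.\<close>

lemma emeasure_sph_meas:
  fixes A :: "(real^'d::finite) set"
  assumes [measurable]: "A \<in> sets borel"
  shows "emeasure sph_meas A
    = of_nat CARD('d) * emeasure lborel {x \<in> ball 0 1 - {0}. x /\<^sub>R norm x \<in> A}"
proof -
  let ?D = "ball 0 1 - {0} :: (real^'d) set"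
  have [measurable]: "(\<lambda>x::real^'d. x /\<^sub>R norm x) \<in> borel_measurable borel" by measurable
  have m: "(\<lambda>x. x /\<^sub>R norm x) \<in> measurable (restrict_space lborel ?D) borel"
    by (intro measurable_restrict_space1) simp
  have "emeasure sph_meas A = of_nat CARD('d) *
      emeasure (restrict_space lborel ?D) ((\<lambda>x. x /\<^sub>R norm x) -` A \<inter> space (restrict_space lborel ?D))"
    unfolding sph_meas_def by (simp add: emeasure_distr[OF m])
  also have "(\<lambda>x. x /\<^sub>R norm x) -` A \<inter> space (restrict_space lborel ?D) = {x \<in> ?D. x /\<^sub>R norm x \<in> A}"
    by (auto simp: space_restrict_space)
  also have "emeasure (restrict_space lborel ?D) \<dots> = emeasure lborel \<dots>"
    by (subst emeasure_restrict_space) auto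
  finally show ?thesis .
qed

lemma sets_sph_meas [simp, measurable_cong]: "sets sph_meas = sets borel"
  by (simp add: sph_meas_def)

lemma space_sph_meas [simp]: "space sph_meas = UNIV"
  by (simp add: sph_meas_def space_scale_measure)

lemma finite_measure_sph_meas: "finite_measure (sph_meas :: (real^'d::finite) measure)"
proof
  have "emeasure lborel {x::real^'d. x \<in> ball 0 1 - {0} \<and> x /\<^sub>R norm x \<in> UNIV} < \<infinity>"
    by (rule emeasure_bounded_finite) (rule bounded_subset[OF bounded_ball[of 0 1]], auto)
  then show "emeasure (sph_meas :: (real^'d) measure) (space sph_meas) \<noteq> \<infinity>"
    by (simp add: emeasure_sph_meas ennreal_mult_eq_top_iff)
qed

text \<open>\<open>sph_meas\<close> is a measure on the whole space. Normalised vectors have norm 1,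
  so the cone over the complement of the sphere is empty. Identities valid only for unit vectors can
  thus be used under the integral.\<close>

lemma AE_sph_meas_norm: "AE x in (sph_meas :: (real^'d::finite) measure). norm x = 1"
proof (rule AE_I')
  let ?N = "{x::real^'d. norm x \<noteq> 1}"
  have N: "?N \<in> sets borel" by measurable
  have "{x::real^'d. x \<in> ball 0 1 - {0} \<and> x /\<^sub>R norm x \<in> ?N} = {}" by (auto simp: divide_simps)
  then have "emeasure sph_meas ?N = 0" using emeasure_sph_meas[OF N] by (simp only: emeasure_empty mult_zero_right)
  then show "?N \<in> null_sets sph_meas" using N by auto
qed auto

text \<open>An orthogonal map commutes with normalisation and preserves the punctured ball, so the
  cone over a preimage is the preimage of the cone, and the invariance of Lebesgue measure carries
  over.\<close>

lemma sph_meas_distr_orthogonal: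
  fixes T :: "real^'d::finite \<Rightarrow> real^'d"
  assumes T: "orthogonal_transformation T"
  shows "distr sph_meas borel T = sph_meas"
proof (rule measure_eqI)
  have lin: "linear T" using T by (rule orthogonal_transformation_linear)
  have T_meas [measurable]: "T \<in> borel_measurable borel"
    by (intro borel_measurable_continuous_onI linear_continuous_on) (simp add: lin linear_conv_bounded_linear[symmetric])
  fix A assume "A \<in> sets (distr sph_meas borel T)"
  then have A [measurable]: "A \<in> sets borel" by simp
  have TA: "T -` A \<in> sets borel" using measurable_sets[OF T_meas A] by simp
  define S where "S = {x \<in> ball 0 1 - {0}. x /\<^sub>R norm x \<in> A}"
  have S [measurable]: "S \<in> sets borel" unfolding S_def by measurable
  have "emeasure (distr sph_meas borel T) A = emeasure sph_meas (T -` A)"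
    by (subst emeasure_distr) (auto cong: measurable_cong_sets)
  also have "\<dots> = of_nat CARD('d) * emeasure lborel {x \<in> ball 0 1 - {0}. x /\<^sub>R norm x \<in> T -` A}"
    by (rule emeasure_sph_meas[OF TA])
  also have "{x \<in> ball 0 1 - {0}. x /\<^sub>R norm x \<in> T -` A} = T -` S"
    using orthogonal_transformation_norm[OF T] linear_scale[OF lin] linear_0[OF lin] 
    by (auto simp: S_def) (metis norm_eq_zero)+
  also have "emeasure lborel (T -` S) = emeasure (distr lborel borel T) S"
    by (subst emeasure_distr) auto
  also have "\<dots> = emeasure lborel S" by (simp add: lborel_distr_orthogonal[OF T])
  finally show "emeasure (distr sph_meas borel T) A = emeasure sph_meas A"
    using emeasure_sph_meas[OF A] unfolding S_def by simp
qed simp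

section \<open>Orthogonality of spherical harmonics\<close>

text \<open>The line through \<open>x\<close> is the one used in \<open>laplacian\<close>, so that
  on polynomials the latter becomes a sum of iterated \<open>pd\<close>.\<close>

definition pd :: "'d \<Rightarrow> (real^'d::finite \<Rightarrow> real) \<Rightarrow> real^'d \<Rightarrow> real" where
  "pd i f x = deriv (\<lambda>u. f (x + u *\<^sub>R axis i 1)) 0"

lemma sum_axis_mult:
  fixes g :: "'d::finite \<Rightarrow> real"
  shows "(\<Sum>k\<in>UNIV. axis i 1 $ k * g k) = g i"
proof -
  have "(\<Sum>k\<in>UNIV. axis i 1 $ k * g k) = (\<Sum>k\<in>UNIV. if k = i then g k else 0)"
    by (intro sum.cong) (auto simp: axis_def)
  then show ?thesis by simp
qed

lemma sum_scaleR_axis_mult: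
  fixes g :: "'d::finite \<Rightarrow> real"
  shows "(\<Sum>k\<in>UNIV. (c *\<^sub>R axis i 1) $ k * g k) = c * g i"
  using sum_axis_mult[of i g] by (simp add: mult.assoc flip: sum_distrib_left)

lemma polyfun_sum:
  assumes "\<And>i. i \<in> I \<Longrightarrow> polyfun (f i)"
  shows "polyfun (\<lambda>x. \<Sum>i\<in>I. f i x)"
  using assms by (induction I rule: infinite_finite_induct) (auto intro: polyfun.intros)

lemma polyfun_uminus: "polyfun f \<Longrightarrow> polyfun (\<lambda>x. - f x)"
  using pf_mult[OF pf_const[of "-1"], of f] by simp

lemma polyfun_diff: "polyfun f \<Longrightarrow> polyfun g \<Longrightarrow> polyfun (\<lambda>x. f x - g x)"
  using pf_add[OF _ polyfun_uminus, of f g] by simp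

text \<open>The induction builds some polynomial gradient together with total differentiability; it
  is identified with \<open>pd\<close> only afterwards, by differentiating along coordinate
  lines.\<close>

lemma polyfun_has_derivative_aux:
  fixes f :: "real^'d::finite \<Rightarrow> real"
  assumes "polyfun f"
  shows "\<exists>g. (\<forall>i. polyfun (g i)) \<and> (\<forall>x. (f has_derivative (\<lambda>v. \<Sum>i\<in>UNIV. v $ i * g i x)) (at x))"
  using assms
proof induction
  case (pf_const c)
  show ?case by (rule exI[of _ "\<lambda>i x. 0"]) (auto intro: polyfun.intros)
next
  case (pf_coord i)
  have *: "(\<lambda>v::real^'d. \<Sum>j\<in>UNIV. v $ j * (if j = i then 1 else 0)) = (\<lambda>v. v $ i)"
    by (simp add: if_distrib cong: if_cong)
  show ?case
    by (rule exI[of _ "\<lambda>j x. if j = i then 1 else 0"])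
       (auto intro: polyfun.intros bounded_linear.has_derivative[OF bounded_linear_vec_nth] simp: *)
next
  case (pf_add f g)
  then obtain f' g' where "\<forall>i. polyfun (f' i)" "\<forall>i. polyfun (g' i)"
    "\<forall>x. (f has_derivative (\<lambda>v. \<Sum>i\<in>UNIV. v $ i * f' i x)) (at x)"
    "\<forall>x. (g has_derivative (\<lambda>v. \<Sum>i\<in>UNIV. v $ i * g' i x)) (at x)" by blast
  then show ?case
    by (intro exI[of _ "\<lambda>i x. f' i x + g' i x"])
       (auto intro!: polyfun.intros has_derivative_add simp: distrib_left sum.distrib)
next
  case (pf_mult f g)
  then obtain f' g' where *: "\<forall>i. polyfun (f' i)" "\<forall>i. polyfun (g' i)"
    "\<And>x. (f has_derivative (\<lambda>v. \<Sum>i\<in>UNIV. v $ i * f' i x)) (at x)"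
    "\<And>x. (g has_derivative (\<lambda>v. \<Sum>i\<in>UNIV. v $ i * g' i x)) (at x)" by blast
  have "((\<lambda>x. f x * g x) has_derivative (\<lambda>v. \<Sum>i\<in>UNIV. v $ i * (f x * g' i x + f' i x * g x))) (at x)" for x
    by (rule has_derivative_eq_rhs[OF has_derivative_mult[OF *(3,4)]])
       (simp add: algebra_simps sum.distrib sum_distrib_left)
  then show ?case using * pf_mult(1,2)
    by (intro exI[of _ "\<lambda>i x. f x * g' i x + f' i x * g x"]) (auto intro!: polyfun.intros)
qed

lemma has_derivative_imp_pd:
  fixes f :: "real^'d::finite \<Rightarrow> real"
  assumes "(f has_derivative (\<lambda>v. \<Sum>i\<in>UNIV. v $ i * g i x)) (at x)"
  shows "pd i f x = g i x"
proof -
  have "((\<lambda>u. x + u *\<^sub>R axis i 1) has_derivative (\<lambda>u. u *\<^sub>R axis i (1::real))) (at 0)"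
    by (auto intro!: derivative_eq_intros)
  moreover have "(f has_derivative (\<lambda>v. \<Sum>i\<in>UNIV. v $ i * g i x)) (at (x + 0 *\<^sub>R axis i 1))"
    using assms by simp
  ultimately have "((\<lambda>u. f (x + u *\<^sub>R axis i 1)) has_derivative
      (\<lambda>u. \<Sum>j\<in>UNIV. (u *\<^sub>R axis i (1::real)) $ j * g j x)) (at 0)"
    by (rule has_derivative_compose)
  also have "(\<lambda>u. \<Sum>j\<in>UNIV. (u *\<^sub>R axis i (1::real)) $ j * g j x) = (*) (g i x)"
    by (simp only: sum_scaleR_axis_mult fun_eq_iff mult.commute[of "g i x"] simp_thms)
  finally show ?thesis
    unfolding pd_def by (intro DERIV_imp_deriv) (simp add: has_field_derivative_def)
qed

lemma polyfun_has_derivative: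
  fixes f :: "real^'d::finite \<Rightarrow> real"
  assumes "polyfun f"
  shows "(f has_derivative (\<lambda>v. \<Sum>i\<in>UNIV. v $ i * pd i f x)) (at x)"
proof -
  obtain g where g: "\<And>x. (f has_derivative (\<lambda>v. \<Sum>i\<in>UNIV. v $ i * g i x)) (at x)"
    using polyfun_has_derivative_aux[OF assms] by blast
  then show ?thesis using has_derivative_imp_pd[of f g x, OF g] by simp
qed

lemma polyfun_pd:
  fixes f :: "real^'d::finite \<Rightarrow> real"
  assumes "polyfun f"
  shows "polyfun (pd i f)"
proof -
  obtain g where g: "\<And>i. polyfun (g i)" "\<And>x. (f has_derivative (\<lambda>v. \<Sum>i\<in>UNIV. v $ i * g i x)) (at x)"
    using polyfun_has_derivative_aux[OF assms] by blast
  have "pd i f = g i" using has_derivative_imp_pd[of f g, OF g(2)] by blast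
  then show ?thesis using g(1) by simp
qed

lemma polyfun_continuous_on: "polyfun f \<Longrightarrow> continuous_on S f"
  by (induction rule: polyfun.induct) (auto intro!: continuous_intros)

lemma pd_mult:
  assumes "polyfun f" "polyfun g"
  shows "pd i (\<lambda>x. f x * g x) x = pd i f x * g x + f x * pd i g x"
proof -
  have "((\<lambda>x. f x * g x) has_derivative
      (\<lambda>v. \<Sum>i\<in>UNIV. v $ i * (pd i f x * g x + f x * pd i g x))) (at x)"
    by (rule has_derivative_eq_rhs[OF has_derivative_mult[OF polyfun_has_derivative[OF assms(1)] polyfun_has_derivative[OF assms(2)]]])
       (simp add: algebra_simps sum.distrib sum_distrib_left)
  then show ?thesis by (rule has_derivative_imp_pd)
qed

lemma pd_coord: "pd j (\<lambda>x::real^'d::finite. x $ i) x = (if j = i then 1 else 0)"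
proof -
  have *: "(\<lambda>v::real^'d. \<Sum>j\<in>UNIV. v $ j * (if j = i then 1 else 0)) = (\<lambda>v. v $ i)"
    by (simp add: if_distrib cong: if_cong)
  have "((\<lambda>x::real^'d. x $ i) has_derivative (\<lambda>v. \<Sum>j\<in>UNIV. v $ j * (if j = i then 1 else 0))) (at x)"
    unfolding * by (intro bounded_linear.has_derivative[OF bounded_linear_vec_nth] has_derivative_ident)
  then show ?thesis by (rule has_derivative_imp_pd)
qed

text \<open>Chain rule along a curve, applied below to coordinate lines, to rays through the origin
  and to orbits of rotations.\<close>

lemma polyfun_DERIV_path:
  fixes f :: "real^'d::finite \<Rightarrow> real"
  assumes "polyfun f" "(p has_vector_derivative v) (at t)"
  shows "((\<lambda>t. f (p t)) has_real_derivative (\<Sum>i\<in>UNIV. v $ i * pd i f (p t))) (at t)"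
proof -
  have "((\<lambda>t. f (p t)) has_derivative (\<lambda>u. \<Sum>i\<in>UNIV. (u *\<^sub>R v) $ i * pd i f (p t))) (at t)"
    using has_derivative_compose[OF assms(2)[unfolded has_vector_derivative_def] polyfun_has_derivative[OF assms(1)]] .
  also have "(\<lambda>u. \<Sum>i\<in>UNIV. (u *\<^sub>R v) $ i * pd i f (p t)) = (*) (\<Sum>i\<in>UNIV. v $ i * pd i f (p t))"
    by (auto simp: fun_eq_iff sum_distrib_left mult_ac)
  finally show ?thesis by (simp add: has_field_derivative_def)
qed

lemma laplacian_polyfun:
  fixes f :: "real^'d::finite \<Rightarrow> real"
  assumes f: "polyfun f"
  shows "laplacian f x = (\<Sum>i\<in>UNIV. pd i (pd i f) x)"
proof -
  have "deriv (\<lambda>u. f (x + u *\<^sub>R axis i 1)) u = pd i f (x + u *\<^sub>R axis i 1)" for i u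
  proof (rule DERIV_imp_deriv)
    have "((\<lambda>u. x + u *\<^sub>R axis i 1) has_vector_derivative axis i (1::real)) (at u)"
      by (auto intro!: derivative_eq_intros)
    from polyfun_DERIV_path[OF f this]
    show "((\<lambda>u. f (x + u *\<^sub>R axis i 1)) has_real_derivative pd i f (x + u *\<^sub>R axis i 1)) (at u)"
      by (simp only: sum_axis_mult)
  qed
  then have *: "deriv (\<lambda>u. f (x + u *\<^sub>R axis i 1)) = (\<lambda>u. pd i f (x + u *\<^sub>R axis i 1))" for i by blast
  show ?thesis unfolding laplacian_def * by (simp add: pd_def[symmetric])
qed

text \<open>Differentiate \<open>f (t *\<^sub>R x) = t ^ m * f x\<close> at \<open>t = 1\<close> in
  two ways.\<close>

lemma euler_homogeneous:
  fixes f :: "real^'d::finite \<Rightarrow> real"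
  assumes f: "polyfun f" and hom: "\<And>t. f (t *\<^sub>R x) = t ^ m * f x"
  shows "(\<Sum>i\<in>UNIV. x $ i * pd i f x) = real m * f x"
proof -
  have "((\<lambda>t. t *\<^sub>R x) has_vector_derivative x) (at (1::real))"
    by (auto intro!: derivative_eq_intros)
  from polyfun_DERIV_path[OF f this]
  have "((\<lambda>t. t ^ m * f x) has_real_derivative (\<Sum>i\<in>UNIV. x $ i * pd i f x)) (at 1)"
    by (simp add: hom)
  moreover have "((\<lambda>t. t ^ m * f x) has_real_derivative real m * f x) (at 1)"
    by (auto intro!: derivative_eq_intros)
  ultimately show ?thesis by (rule DERIV_unique)
qed

text \<open>Partial derivatives are homogeneous of degree \<open>m - 1\<close>. Stating this as
  \<open>t * pd j f (t *\<^sub>R x) = t ^ m * pd j f x\<close> avoids natural subtraction and covers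
  \<open>m = 0\<close>; differentiating it at \<open>t = 1\<close> gives the claim.\<close>

lemma euler_homogeneous_pd:
  fixes f :: "real^'d::finite \<Rightarrow> real"
  assumes f: "polyfun f" and hom: "\<And>t x. f (t *\<^sub>R x) = t ^ m * f x"
  shows "(\<Sum>i\<in>UNIV. x $ i * pd i (pd j f) x) = (real m - 1) * pd j f x"
proof -
  have pdhom: "t * pd j f (t *\<^sub>R x) = t ^ m * pd j f x" for t
  proof -
    have line: "((\<lambda>u. x + u *\<^sub>R axis j 1) has_vector_derivative axis j (1::real)) (at 0)"
      by (auto intro!: derivative_eq_intros)
    from polyfun_DERIV_path[OF f bounded_linear.has_vector_derivative[OF bounded_linear_scaleR_right this], of t]
    have "((\<lambda>u. t ^ m * f (x + u *\<^sub>R axis j 1)) has_real_derivative t * pd j f (t *\<^sub>R x)) (at 0)"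
      by (simp only: hom sum_scaleR_axis_mult scaleR_zero_left add_0_right)
    moreover from DERIV_cmult[OF polyfun_DERIV_path[OF f line], of "t ^ m"]
    have "((\<lambda>u. t ^ m * f (x + u *\<^sub>R axis j 1)) has_real_derivative t ^ m * pd j f x) (at 0)"
      by (simp only: sum_axis_mult scaleR_zero_left add_0_right)
    ultimately show ?thesis by (rule DERIV_unique)
  qed
  have "((\<lambda>t. t *\<^sub>R x) has_vector_derivative x) (at (1::real))"
    by (auto intro!: derivative_eq_intros)
  from DERIV_mult[OF DERIV_ident polyfun_DERIV_path[OF polyfun_pd[OF f, of j] this]]
  have "((\<lambda>t. t ^ m * pd j f x) has_real_derivative
      pd j f x + (\<Sum>i\<in>UNIV. x $ i * pd i (pd j f) x)) (at 1)"
    by (simp add: pdhom)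
  moreover have "((\<lambda>t. t ^ m * pd j f x) has_real_derivative real m * pd j f x) (at 1)"
    by (auto intro!: derivative_eq_intros)
  ultimately have "pd j f x + (\<Sum>i\<in>UNIV. x $ i * pd i (pd j f) x) = real m * pd j f x"
    by (rule DERIV_unique)
  then show ?thesis by (simp add: algebra_simps)
qed

section \<open>Integrability of polynomials over the sphere\<close>

lemma polyfun_bounded_sphere:
  fixes f :: "real^'d::finite \<Rightarrow> real"
  assumes "polyfun f"
  obtains B where "\<And>x. norm x = 1 \<Longrightarrow> \<bar>f x\<bar> \<le> B"
proof -
  have "bounded (f ` sphere 0 1)"
    by (intro compact_imp_bounded compact_continuous_image polyfun_continuous_on assms) simp
  then obtain a where "\<forall>x\<in>sphere 0 1. \<bar>f x\<bar> \<le> a" by (auto simp: bounded_iff)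
  then show thesis by (intro that[of a]) simp
qed

lemma polyfun_borel_measurable: "polyfun f \<Longrightarrow> f \<in> borel_measurable borel"
  by (intro borel_measurable_continuous_onI polyfun_continuous_on)

lemma integrable_sph_meas_polyfun:
  fixes f :: "real^'d::finite \<Rightarrow> real"
  assumes "polyfun f"
  shows "integrable sph_meas f"
proof -
  obtain B where B: "\<And>x. norm x = 1 \<Longrightarrow> \<bar>f x\<bar> \<le> B" by (rule polyfun_bounded_sphere[OF assms]) blast
  interpret finite_measure "sph_meas :: (real^'d) measure" by (rule finite_measure_sph_meas)
  show ?thesis
  proof (rule integrable_const_bound)
    show "AE x in sph_meas. norm (f x) \<le> B" using AE_sph_meas_norm by eventually_elim (simp add: B)
    show "f \<in> borel_measurable sph_meas"
      using polyfun_borel_measurable[OF assms] by (simp cong: measurable_cong_sets)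
  qed
qed

section \<open>Plane rotations and angular derivatives\<close>

text \<open>Rotation by the angle \<open>t\<close> in the plane of two distinct axes, written as the
  identity plus a correction along these axes to avoid a case distinction over coordinates.\<close>

definition plane_rot :: "'d \<Rightarrow> 'd \<Rightarrow> real \<Rightarrow> real^'d::finite \<Rightarrow> real^'d" where
  "plane_rot i j t x = x + (x $ i * (cos t - 1) - x $ j * sin t) *\<^sub>R axis i 1
     + (x $ j * (cos t - 1) + x $ i * sin t) *\<^sub>R axis j 1"

lemma orthogonal_transformation_plane_rot:
  assumes "i \<noteq> j"
  shows "orthogonal_transformation (plane_rot i j t :: real^'d::finite \<Rightarrow> real^'d)"
  unfolding orthogonal_transformation
proof
  show "linear (plane_rot i j t :: real^'d \<Rightarrow> real^'d)"
    by (rule linearI) (simp_all add: plane_rot_def algebra_simps)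
  show "\<forall>v::real^'d. norm (plane_rot i j t v) = norm v"
  proof
    fix v :: "real^'d"
    have "(v $ i * cos t - v $ j * sin t)\<^sup>2 + (v $ j * cos t + v $ i * sin t)\<^sup>2
        = ((v $ i)\<^sup>2 + (v $ j)\<^sup>2) * ((sin t)\<^sup>2 + (cos t)\<^sup>2)"
      by (simp only: power2_eq_square) (simp only: algebra_simps)
    also have "\<dots> = (v $ i)\<^sup>2 + (v $ j)\<^sup>2" by simp
    finally have c: "(v $ i * cos t - v $ j * sin t)\<^sup>2 + (v $ j * cos t + v $ i * sin t)\<^sup>2
        = (v $ i)\<^sup>2 + (v $ j)\<^sup>2" .
    have ij: "axis i (1::real) $ j = 0" "axis j (1::real) $ i = 0"
      using assms by (auto simp: axis_def)
    have "plane_rot i j t v \<bullet> plane_rot i j t v = v \<bullet> v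
        + ((v $ i * cos t - v $ j * sin t)\<^sup>2 + (v $ j * cos t + v $ i * sin t)\<^sup>2)
        - ((v $ i)\<^sup>2 + (v $ j)\<^sup>2)"
      unfolding plane_rot_def
      by (simp add: inner_add_left inner_add_right inner_axis inner_axis' ij)
         (simp add: power2_eq_square algebra_simps)
    then have "plane_rot i j t v \<bullet> plane_rot i j t v = v \<bullet> v" by (simp add: c)
    then show "norm (plane_rot i j t v) = norm v" by (simp add: norm_eq)
  qed
qed

text \<open>The velocity is expressed through the rotated point itself, so that the derivative of a
  function along an orbit is its angular derivative at the current point, for every
  \<open>t\<close>.\<close>

lemma plane_rot_has_vector_derivative:
  assumes "i \<noteq> j"
  shows "((\<lambda>t. plane_rot i j t x) has_vector_derivative
    (- (plane_rot i j t x $ j)) *\<^sub>R axis i 1 + (plane_rot i j t x $ i) *\<^sub>R axis j 1) (at t)"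
proof -
  have "plane_rot i j t x $ j = x $ j * cos t + x $ i * sin t"
    "plane_rot i j t x $ i = x $ i * cos t - x $ j * sin t"
    using assms by (simp_all add: plane_rot_def axis_def algebra_simps)
  then show ?thesis unfolding plane_rot_def
    by (auto intro!: derivative_eq_intros simp: algebra_simps)
qed

text \<open>By rotation invariance the integral of \<open>f\<close> over rotated points is constant
  in the angle, so its derivative at angle 0 vanishes; dominated convergence moves the derivative
  under the integral.\<close>

lemma sph_int_angular_derivative:
  fixes f :: "real^'d::finite \<Rightarrow> real"
  assumes f: "polyfun f"
  shows "sph_int (\<lambda>x. x $ i * pd j f x - x $ j * pd i f x) = 0"
proof (cases "i = j")
  case True
  then show ?thesis by (simp add: sph_int_def)
next
  case False
  let ?L = "\<lambda>x. x $ i * pd j f x - x $ j * pd i f x"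
  let ?R = "plane_rot i j"
  let ?\<tau> = "\<lambda>n. 1 / real (Suc n)"
  have L: "polyfun ?L" by (intro polyfun_diff polyfun.intros polyfun_pd f)
  have D: "((\<lambda>t. f (?R t x)) has_real_derivative ?L (?R t x)) (at t)" for t x
  proof -
    have "(\<Sum>k\<in>UNIV. ((- a) *\<^sub>R axis i (1::real) + b *\<^sub>R axis j 1) $ k * g k) = b * g j - a * g i"
      for a b :: real and g :: "'d \<Rightarrow> real"
      by (simp only: vector_add_component distrib_right sum.distrib sum_scaleR_axis_mult)
    then show ?thesis
      using polyfun_DERIV_path[OF f plane_rot_has_vector_derivative[OF False, of x t]] by simp
  qed
  have R0: "?R 0 x = x" for x by (simp add: plane_rot_def)
  have RI: "integral\<^sup>L sph_meas (\<lambda>x. f (?R t x)) = integral\<^sup>L sph_meas f" 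
    and Rint: "integrable sph_meas (\<lambda>x. f (?R t x))" for t
  proof -
    note T = orthogonal_transformation_plane_rot[OF False, of t]
    have m: "?R t \<in> measurable sph_meas borel"
      using borel_measurable_continuous_onI[OF linear_continuous_on, of "?R t"] T
      by (simp add: linear_conv_bounded_linear[symmetric] orthogonal_transformation_linear cong: measurable_cong_sets)
    show "integral\<^sup>L sph_meas (\<lambda>x. f (?R t x)) = integral\<^sup>L sph_meas f"
      using integral_distr[OF m polyfun_borel_measurable[OF f]] sph_meas_distr_orthogonal[OF T] by simp
    show "integrable sph_meas (\<lambda>x. f (?R t x))"
      using integrable_distr_eq[OF m polyfun_borel_measurable[OF f]] sph_meas_distr_orthogonal[OF T]
        integrable_sph_meas_polyfun[OF f] by simp
  qed
  obtain B where B: "\<And>x. norm x = 1 \<Longrightarrow> \<bar>?L x\<bar> \<le> B" by (rule polyfun_bounded_sphere[OF L]) blast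
  \<comment> \<open>Dominated convergence is used along the angles \<open>1 / (n + 1)\<close>, which
    tend to 0 without reaching it.\<close>
  let ?q = "\<lambda>n x. (f (?R (?\<tau> n) x) - f x) / ?\<tau> n"
  have lim: "(\<lambda>n. integral\<^sup>L sph_meas (?q n)) \<longlonglongrightarrow> integral\<^sup>L sph_meas ?L"
  proof (rule integral_dominated_convergence)
    show "integrable sph_meas (\<lambda>x. B)"
      using finite_measure.integrable_const[OF finite_measure_sph_meas] .
    show "?L \<in> borel_measurable sph_meas" using integrable_sph_meas_polyfun[OF L] by simp
    show "?q n \<in> borel_measurable sph_meas" for n
      using Rint[of "?\<tau> n"] integrable_sph_meas_polyfun[OF f] by (intro borel_measurable_integrable) auto
    show "AE x in sph_meas. (\<lambda>n. ?q n x) \<longlonglongrightarrow> ?L x"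
    proof (rule AE_I2)
      fix x
      have "((\<lambda>h. (f (?R h x) - f x) / h) \<longlongrightarrow> ?L x) (at 0)"
        using D[of x 0] by (simp add: DERIV_def R0)
      moreover have "filterlim ?\<tau> (at 0) sequentially"
        unfolding filterlim_at using LIMSEQ_inverse_real_of_nat by (auto simp: inverse_eq_divide)
      ultimately show "(\<lambda>n. ?q n x) \<longlonglongrightarrow> ?L x" by (rule filterlim_compose)
    qed
    show "AE x in sph_meas. norm (?q n x) \<le> B" for n
      using AE_sph_meas_norm
    proof eventually_elim
      case (elim x)
      \<comment> \<open>The mean value theorem makes the quotient a value of \<open>?L\<close> at a
        rotated unit vector, so the bound of \<open>?L\<close> on the sphere dominates all
        quotients.\<close>
      have "\<exists>z>0. z < ?\<tau> n \<and> f (?R (?\<tau> n) x) - f (?R 0 x) = (?\<tau> n - 0) * ?L (?R z x)"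
        by (rule MVT2) (auto intro: D)
      then obtain z where "?q n x = ?L (?R z x)" by (auto simp: R0)
      moreover have "norm (?R z x) = 1"
        using orthogonal_transformation_norm[OF orthogonal_transformation_plane_rot[OF False]] elim by simp
      ultimately show ?case using B by simp
    qed
  qed
  have "integral\<^sup>L sph_meas (?q n) = 0" for n
    using Rint integrable_sph_meas_polyfun[OF f] RI
    by (simp add: Bochner_Integration.integral_diff del: of_nat_Suc)
  with lim have "(\<lambda>n. 0) \<longlonglongrightarrow> integral\<^sup>L sph_meas ?L" by (simp only:)
  then have "integral\<^sup>L sph_meas ?L = 0" by (rule LIMSEQ_unique) (rule tendsto_const)
  then show ?thesis by (simp only: sph_int_def)
qed

text \<open>
  Integrate \<open>\<Sum>i j. (x\<^sub>i \<partial>\<^sub>j - x\<^sub>j \<partial>\<^sub>i) (x\<^sub>i Z \<partial>\<^sub>j Y)\<close>, which has mean zero by rotation invariance;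
  on the unit sphere Euler's identity and harmonicity of \<open>Y\<close> turn it into
  \<open>\<nabla>Y \<bullet> \<nabla>Z - (d + m + k - 2) m Y Z\<close>.
\<close>
lemma sph_int_gradient_product:
  fixes Y Z :: "real^'d::finite \<Rightarrow> real"
  assumes Y: "Y \<in> sph_harm m" and Z: "Z \<in> sph_harm k"
  shows "sph_int (\<lambda>x. \<Sum>j\<in>UNIV. pd j Y x * pd j Z x)
    = (real CARD('d) + real m + real k - 2) * real m * sph_int (\<lambda>x. Y x * Z x)"
proof -
  have pY: "polyfun Y" and hY: "\<And>t x. Y (t *\<^sub>R x) = t ^ m * Y x" and lY: "\<And>x. laplacian Y x = 0"
    and pZ: "polyfun Z" and hZ: "\<And>t x. Z (t *\<^sub>R x) = t ^ k * Z x"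
    using Y Z by (auto simp: sph_harm_def)
  define c where "c = (real CARD('d) + real m + real k - 2) * real m"
  define G where "G = (\<lambda>j x. pd j Y x * Z x)"
  define H where "H = (\<lambda>i j x. x $ i * G j x)"
  have pG: "polyfun (G j)" for j unfolding G_def by (intro polyfun.intros polyfun_pd pY pZ)
  have pH: "polyfun (H i j)" for i j unfolding H_def by (intro polyfun.intros pG)
  let ?L = "\<lambda>i j x. x $ i * pd j (H i j) x - x $ j * pd i (H i j) x"
  have pL: "polyfun (?L i j)" for i j by (intro polyfun_diff polyfun.intros polyfun_pd pH)
  have pg: "polyfun (\<lambda>x. \<Sum>j\<in>UNIV. pd j Y x * pd j Z x)"
    by (intro polyfun_sum polyfun.intros polyfun_pd pY pZ)
  have pYZ: "polyfun (\<lambda>x. Y x * Z x)" by (intro polyfun.intros pY pZ)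
  \<comment> \<open>Harmonicity of \<open>Y\<close> enters here: it removes the term
    \<open>Z * laplacian Y\<close>.\<close>
  have divG: "(\<Sum>j\<in>UNIV. pd j (G j) x) = (\<Sum>j\<in>UNIV. pd j Y x * pd j Z x)" for x
    using lY[of x] laplacian_polyfun[OF pY, of x]
    by (simp add: G_def pd_mult polyfun_pd pY pZ sum.distrib flip: sum_distrib_right)
  have xG: "(\<Sum>j\<in>UNIV. x $ j * G j x) = real m * Y x * Z x" for x
    using euler_homogeneous[OF pY hY, of x]
    by (simp add: G_def flip: mult.assoc sum_distrib_right)
  \<comment> \<open>Euler's identity for \<open>G j\<close>, a product of factors of degrees
    \<open>m - 1\<close> and \<open>k\<close>.\<close>
  have eG: "(\<Sum>i\<in>UNIV. x $ i * pd i (G j) x) = (real m - 1 + real k) * G j x" for x j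
  proof -
    have "(\<Sum>i\<in>UNIV. x $ i * pd i (G j) x)
        = (\<Sum>i\<in>UNIV. x $ i * pd i (pd j Y) x) * Z x + pd j Y x * (\<Sum>i\<in>UNIV. x $ i * pd i Z x)"
      by (simp add: G_def pd_mult polyfun_pd pY pZ sum.distrib distrib_left sum_distrib_left
          sum_distrib_right mult_ac)
    also have "\<dots> = (real m - 1 + real k) * G j x"
      unfolding euler_homogeneous[OF pZ hZ] euler_homogeneous_pd[OF pY hY]
      by (simp add: G_def algebra_simps)
    finally show ?thesis .
  qed
  have key: "(\<Sum>i\<in>UNIV. \<Sum>j\<in>UNIV. ?L i j x) = (\<Sum>j\<in>UNIV. pd j Y x * pd j Z x) - c * (Y x * Z x)"
    if "norm x = 1" for x
  proof -
    have x1: "(\<Sum>i\<in>UNIV. x $ i * x $ i) = 1"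
      using that by (simp add: norm_eq_1 inner_vec_def)
    \<comment> \<open>The first and third terms come from differentiating the factor
      \<open>x $ i\<close> of \<open>H i j\<close>. Summed over both indices, the first, third and
      fourth terms contribute \<open>1\<close>, \<open>- d\<close> and \<open>- (m - 1 + k)\<close>
      times \<open>m Y Z\<close>, which together give \<open>- c\<close> times
      \<open>Y Z\<close>.\<close>
    have L: "?L i j x = (if i = j then x $ j * G j x else 0) + x $ i * x $ i * pd j (G j) x
       - x $ j * G j x - x $ j * (x $ i * pd i (G j) x)" for i j
      by (simp add: H_def pd_mult pG pf_coord pd_coord algebra_simps)
    have 1: "(\<Sum>i\<in>UNIV. \<Sum>j\<in>UNIV. if i = j then x $ j * G j x else 0) = real m * Y x * Z x"
      using xG[of x] by simp
    have 2: "(\<Sum>i\<in>UNIV. \<Sum>j\<in>UNIV. x $ i * x $ i * pd j (G j) x) = (\<Sum>j\<in>UNIV. pd j Y x * pd j Z x)"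
      using divG[of x] x1 by (simp flip: sum_distrib_left sum_distrib_right)
    have 3: "(\<Sum>i\<in>(UNIV :: 'd set). \<Sum>j\<in>UNIV. x $ j * G j x) = real CARD('d) * (real m * Y x * Z x)"
      using xG[of x] by simp
    have "(\<Sum>i\<in>UNIV. \<Sum>j\<in>UNIV. x $ j * (x $ i * pd i (G j) x))
        = (\<Sum>j\<in>UNIV. x $ j * (\<Sum>i\<in>UNIV. x $ i * pd i (G j) x))"
      by (subst sum.swap) (simp add: sum_distrib_left)
    also have "\<dots> = (real m - 1 + real k) * (\<Sum>j\<in>UNIV. x $ j * G j x)"
      by (simp add: eG sum_distrib_left mult_ac)
    finally have 4: "(\<Sum>i\<in>UNIV. \<Sum>j\<in>UNIV. x $ j * (x $ i * pd i (G j) x))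
        = (real m - 1 + real k) * (real m * Y x * Z x)" by (simp add: xG)
    show ?thesis
      unfolding L sum.distrib sum_subtractf 1 2 3 4 by (simp add: c_def algebra_simps)
  qed
  have "AE x in sph_meas. (\<Sum>i\<in>UNIV. \<Sum>j\<in>UNIV. ?L i j x)
      = (\<Sum>j\<in>UNIV. pd j Y x * pd j Z x) - c * (Y x * Z x)"
    using AE_sph_meas_norm by eventually_elim (rule key)
  then have "integral\<^sup>L sph_meas (\<lambda>x. \<Sum>i\<in>UNIV. \<Sum>j\<in>UNIV. ?L i j x)
      = integral\<^sup>L sph_meas (\<lambda>x. (\<Sum>j\<in>UNIV. pd j Y x * pd j Z x) - c * (Y x * Z x))"
    by (intro integral_cong_AE borel_measurable_integrable integrable_sph_meas_polyfun polyfun_sum pL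
        polyfun_diff pg pf_mult[OF pf_const pYZ])
  moreover have "integral\<^sup>L sph_meas (\<lambda>x. \<Sum>i\<in>UNIV. \<Sum>j\<in>UNIV. ?L i j x) = 0"
  proof -
    have "integral\<^sup>L sph_meas (\<lambda>x. \<Sum>i\<in>UNIV. \<Sum>j\<in>UNIV. ?L i j x)
        = (\<Sum>i\<in>UNIV. integral\<^sup>L sph_meas (\<lambda>x. \<Sum>j\<in>UNIV. ?L i j x))"
      by (rule Bochner_Integration.integral_sum) (intro integrable_sph_meas_polyfun polyfun_sum pL)
    also have "\<dots> = (\<Sum>i\<in>UNIV. \<Sum>j\<in>UNIV. integral\<^sup>L sph_meas (?L i j))"
      by (intro sum.cong refl Bochner_Integration.integral_sum integrable_sph_meas_polyfun pL)
    also have "\<dots> = 0"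
      using sph_int_angular_derivative[OF pH] by (simp only: sph_int_def sum.neutral_const)
    finally show ?thesis .
  qed
  ultimately show ?thesis
    by (simp add: sph_int_def c_def integrable_sph_meas_polyfun pg pYZ)
qed

text \<open>The gradient integral is symmetric in \<open>Y\<close> and \<open>Z\<close>, which gives
  \<open>a m I = a k I\<close> with \<open>a = d + m + k - 2\<close>. This factor is positive, since
  \<open>d \<ge> 2\<close> and distinct degrees are not both 0.\<close>

lemma sph_harm_orthogonal:
  fixes Y Z :: "real^'d::finite \<Rightarrow> real"
  assumes d: "CARD('d) \<ge> 2" and Y: "Y \<in> sph_harm m" and Z: "Z \<in> sph_harm k" and mk: "m \<noteq> k"
  shows "sph_int (\<lambda>x. Y x * Z x) = 0"
proof -
  let ?a = "real CARD('d) + real m + real k - 2" and ?I = "sph_int (\<lambda>x. Y x * Z x)"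
  have "?a * real m * ?I = ?a * real k * ?I"
  proof -
    have "(\<lambda>x. Z x * Y x) = (\<lambda>x. Y x * Z x)"
      "(\<lambda>x. \<Sum>j\<in>UNIV. pd j Z x * pd j Y x) = (\<lambda>x. \<Sum>j\<in>UNIV. pd j Y x * pd j Z x)"
      by (simp_all add: mult.commute)
    then show ?thesis
      using sph_int_gradient_product[OF Y Z] sph_int_gradient_product[OF Z Y] by (simp add: add_ac)
  qed
  moreover have "?a > 0" using d mk by linarith
  ultimately show ?thesis using mk by simp
qed

section \<open>Jacobi polynomials\<close>

text \<open>Up to sign this is the \<open>n\<close>-th finite difference of \<open>p\<close> at 0.
  Pascal's rule passes from \<open>p\<close> to its difference \<open>q\<close>, whose degree is
  smaller because \<open>p\<close> and its shift have the same leading coefficient.\<close>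

lemma alternating_binomial_sum_poly_eq_0:
  fixes p :: "real poly"
  assumes "degree p < n"
  shows "(\<Sum>k\<le>n. (-1) ^ k * real (n choose k) * poly p (real k)) = 0"
  using assms
proof (induction n arbitrary: p)
  case 0
  then show ?case by simp
next
  case (Suc n)
  define q where "q = p - pcompose p [:1, 1:]"
  have q: "poly q x = poly p x - poly p (x + 1)" for x by (simp add: q_def poly_pcompose add.commute)
  let ?f = "\<lambda>k. (-1) ^ k * poly p (real k)"
  \<comment> \<open>The reindexed sum runs one index too far, where \<open>n choose Suc n\<close> is
    zero.\<close>
  have 1: "(\<Sum>k\<le>n. real (n choose Suc k) * ?f (Suc k)) + ?f 0 = (\<Sum>k\<le>n. real (n choose k) * ?f k)"
  proof -
    have "(\<Sum>k\<le>Suc n. real (n choose k) * ?f k) = ?f 0 + (\<Sum>k\<le>n. real (n choose Suc k) * ?f (Suc k))"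
      by (subst sum.atMost_Suc_shift) simp
    then show ?thesis by (simp add: binomial_eq_0)
  qed
  have "(\<Sum>k\<le>Suc n. (-1) ^ k * real (Suc n choose k) * poly p (real k))
      = ?f 0 + (\<Sum>k\<le>n. real (n choose k) * ?f (Suc k) + real (n choose Suc k) * ?f (Suc k))"
    by (subst sum.atMost_Suc_shift) (simp add: algebra_simps)
  also have "\<dots> = (\<Sum>k\<le>n. real (n choose k) * ?f (Suc k)) + (\<Sum>k\<le>n. real (n choose k) * ?f k)"
    using 1 by (simp only: sum.distrib)
  also have "\<dots> = (\<Sum>k\<le>n. (-1) ^ k * real (n choose k) * poly q (real k))"
    by (simp add: q sum.distrib[symmetric] algebra_simps)
  also have "\<dots> = 0"
  proof (cases "degree p = 0")
    case True
    then obtain c where "p = [:c:]" by (metis degree_eq_zeroE)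
    then show ?thesis by (simp add: q)
  next
    case False
    have "degree q \<le> degree p" unfolding q_def by (rule degree_diff_le) (auto simp: degree_pcompose)
    moreover have "coeff q (degree p) = 0"
      using lead_coeff_comp[of "[:1, 1::real:]" p] by (simp add: q_def degree_pcompose)
    ultimately have "q = 0 \<or> degree q < degree p" by (rule eq_zero_or_degree_less)
    with False Suc.prems have "degree q < n" by auto
    then show ?thesis by (rule Suc.IH)
  qed
  finally show ?case .
qed

text \<open>With second parameter 0 the Pochhammer symbols of lengths \<open>n - k\<close> and
  \<open>k\<close> are adjacent and merge into one of length \<open>n\<close>; the substitution
  \<open>u = 1 - 2 * t\<close> turns \<open>(1 - u) / 2\<close> into \<open>t\<close>.\<close>

lemma jacobiP_unit_interval:
  "jacobiP n a 0 (1 - 2 * t)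
    = (\<Sum>k\<le>n. (-1) ^ k * real (n choose k) * pochhammer (a + real k + 1) n / fact n * t ^ k)"
proof -
  have "pochhammer (a + real k + 1) (n - k) * pochhammer (- real n) k * pochhammer (real n + a + 0 + 1) k
       / (fact n * fact k) * ((1 - (1 - 2 * t)) / 2) ^ k
     = (-1) ^ k * real (n choose k) * pochhammer (a + real k + 1) n / fact n * t ^ k"
    if "k \<le> n" for k
  proof -
    have "pochhammer (a + real k + 1) n
        = pochhammer (a + real k + 1) (n - k) * pochhammer (real n + a + 0 + 1) k"
      using pochhammer_product'[of "a + real k + 1" "n - k" k] that by (simp add: of_nat_diff add_ac)
    moreover have "pochhammer (- real n) k / fact k = (-1) ^ k * real (n choose k)"
      by (simp add: binomial_gbinomial gbinomial_pochhammer)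
    then have "pochhammer (- real n) k = (-1) ^ k * real (n choose k) * fact k"
      by (simp add: divide_simps)
    ultimately show ?thesis by simp
  qed
  then show ?thesis
    unfolding jacobiP_def atLeast0AtMost by (intro sum.cong) auto
qed

text \<open>
  For \<open>j < n\<close> the denominator is one of the factors of the Pochhammer symbol, so the sum is an
  \<open>n\<close>-th difference of a polynomial of degree \<open>n - 1\<close>.
\<close>
lemma jacobi_coeff_orthogonal:
  assumes "j < n" "a > -1"
  shows "(\<Sum>k\<le>n. (-1) ^ k * real (n choose k) * pochhammer (a + real k + 1) n * (1 / (a + real j + real k + 1))) = 0"
proof -
  define p where "p = (\<Prod>i\<in>{..<n} - {j}. [:a + 1 + real i, 1:])"
  have p: "pochhammer (a + real k + 1) n * (1 / (a + real j + real k + 1)) = poly p (real k)" for k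
  proof -
    have "pochhammer (a + real k + 1) n = (a + real k + 1 + real j) * (\<Prod>i\<in>{..<n} - {j}. a + real k + 1 + real i)"
      unfolding pochhammer_prod atLeast0LessThan using assms by (subst prod.remove[of _ j]) auto
    moreover have "a + real j + real k + 1 \<noteq> 0" using assms by linarith
    ultimately show ?thesis by (simp add: p_def poly_prod add_ac)
  qed
  have "degree p \<le> (\<Sum>i\<in>{..<n} - {j}. 1)"
    unfolding p_def by (rule order.trans[OF degree_prod_sum_le]) (auto intro!: sum_mono)
  also have "\<dots> < n" using assms by simp
  finally show ?thesis
    using alternating_binomial_sum_poly_eq_0[of p n] by (simp only: mult.assoc p)
qed

section \<open>Jacobi orthogonality and norms on the unit interval\<close>

text \<open>Bundling integrability with the value lets finite sums be integrated termwise. For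
  \<open>b < 0\<close> the integrand is unbounded near 0; absolute integrability then follows from
  nonnegativity.\<close>

lemma has_bochner_integral_powr_unit_interval:
  assumes "b > -1"
  shows "has_bochner_integral lborel (\<lambda>t. indicator (einterval 0 1) t *\<^sub>R t powr b) (1 / (b + 1))"
proof -
  have *: "((\<lambda>t. t powr b) has_integral (1 / (b + 1))) {0..1}"
    using has_integral_powr_from_0[OF assms, of 1] by simp
  have "(\<lambda>t. t powr b) absolutely_integrable_on {0..1}"
    using * by (intro nonnegative_absolutely_integrable_1) auto
  then have si: "set_integrable lborel {0..1} (\<lambda>t. t powr b)"
    unfolding set_integrable_def by (subst (asm) integrable_completion) auto
  have E: "einterval 0 1 = {0<..<1::real}" by (auto simp: einterval_def zero_ereal_def one_ereal_def)
  have si': "set_integrable lborel (einterval 0 1) (\<lambda>t. t powr b)"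
    unfolding E by (rule set_integrable_subset[OF si]) auto
  have "(LBINT t:einterval 0 1. t powr b) = (LBINT t=0..1. t powr b)"
    by (subst interval_lebesgue_integral_le_eq) auto
  also have "\<dots> = integral {0..1} (\<lambda>t. t powr b)"
    using interval_integral_eq_integral[OF _ si] by (simp add: zero_ereal_def one_ereal_def)
  also have "\<dots> = 1 / (b + 1)" using * by (rule integral_unique)
  finally show ?thesis
    using si' unfolding set_integrable_def set_lebesgue_integral_def has_bochner_integral_iff by simp
qed

lemma interval_integral_unit_interval:
  "(LBINT t=0..1. f t) = integral\<^sup>L lborel (\<lambda>t. indicator (einterval 0 1) t *\<^sub>R f t)" for f :: "real \<Rightarrow> real"
  by (subst interval_lebesgue_integral_le_eq) (auto simp: set_lebesgue_integral_def)

text \<open>Expand both factors in powers of \<open>t\<close> and integrate termwise. For each power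
  \<open>t ^ j\<close> of the factor with index \<open>n'\<close>, the sum over the coefficients of
  the other factor vanishes because \<open>j < n\<close>.\<close>

lemma jacobiP_orthogonal_less:
  assumes "n' < n" "a > -1"
  shows "(LBINT t=0..1. t powr a * (jacobiP n a 0 (1 - 2 * t) * jacobiP n' a 0 (1 - 2 * t))) = 0"
proof -
  define c where "c = (\<lambda>n k. (-1) ^ k * real (n choose k) * pochhammer (a + real k + 1) n / fact n)"
  have P: "jacobiP n a 0 (1 - 2 * t) = (\<Sum>k\<le>n. c n k * t ^ k)" for n t
    unfolding c_def by (rule jacobiP_unit_interval)
  let ?e = "indicator (einterval 0 1) :: real \<Rightarrow> real"
  have expand: "?e t *\<^sub>R (t powr a * (jacobiP n a 0 (1 - 2 * t) * jacobiP n' a 0 (1 - 2 * t)))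
      = (\<Sum>j\<le>n'. \<Sum>k\<le>n. (c n' j * c n k) * (?e t *\<^sub>R t powr (a + real j + real k)))" for t
  \<comment> \<open>Outside the interval both sides are 0; inside, \<open>t > 0\<close> allows
    ordinary powers to be absorbed into \<open>powr\<close>.\<close>
  proof (cases "t \<in> einterval 0 1")
    case True
    then have t: "t > 0" by (auto simp: einterval_def)
    have "t powr (a + real j + real k) = t powr a * (t ^ k * t ^ j)" for j k
      using t by (simp add: powr_add powr_realpow)
    moreover have "jacobiP n a 0 (1 - 2 * t) * jacobiP n' a 0 (1 - 2 * t)
        = (\<Sum>j\<le>n'. \<Sum>k\<le>n. c n k * t ^ k * (c n' j * t ^ j))"
      unfolding P sum_product by (rule sum.swap)
    ultimately show ?thesis
      using True by (simp only: sum_distrib_left) (simp add: mult_ac)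
  qed simp
  have "has_bochner_integral lborel
      (\<lambda>t. \<Sum>j\<le>n'. \<Sum>k\<le>n. (c n' j * c n k) * (?e t *\<^sub>R t powr (a + real j + real k)))
      (\<Sum>j\<le>n'. \<Sum>k\<le>n. (c n' j * c n k) * (1 / (a + real j + real k + 1)))"
    using assms
    by (intro has_bochner_integral_sum has_bochner_integral_mult_right has_bochner_integral_powr_unit_interval) auto
  moreover have "(\<Sum>k\<le>n. (c n' j * c n k) * (1 / (a + real j + real k + 1))) = 0" if "j \<le> n'" for j
  proof -
    have "(\<Sum>k\<le>n. (c n' j * c n k) * (1 / (a + real j + real k + 1)))
      = c n' j / fact n * (\<Sum>k\<le>n. (-1) ^ k * real (n choose k) * pochhammer (a + real k + 1) n * (1 / (a + real j + real k + 1)))"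
      unfolding sum_distrib_left by (intro sum.cong) (auto simp: c_def)
    then show ?thesis using jacobi_coeff_orthogonal[of j n a] that assms by simp
  qed
  then have "(\<Sum>j\<le>n'. \<Sum>k\<le>n. (c n' j * c n k) * (1 / (a + real j + real k + 1))) = 0"
    by (intro sum.neutral) simp
  ultimately have "has_bochner_integral lborel
      (\<lambda>t. \<Sum>j\<le>n'. \<Sum>k\<le>n. (c n' j * c n k) * (?e t *\<^sub>R t powr (a + real j + real k))) 0"
    by metis
  then show ?thesis
    unfolding interval_integral_unit_interval expand by (rule has_bochner_integral_integral_eq)
qed

lemma jacobiPhat_orthogonal:
  assumes "n \<noteq> n'" "a > -1"
  shows "(LBINT t=0..1. t powr a * (jacobiPhat n a 0 (1 - 2 * t) * jacobiPhat n' a 0 (1 - 2 * t))) = 0"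
proof -
  have "(LBINT t=0..1. t powr a * (jacobiP n a 0 (1 - 2 * t) * jacobiP n' a 0 (1 - 2 * t))) = 0"
  proof (cases "n' < n")
    case True
    then show ?thesis using assms by (intro jacobiP_orthogonal_less)
  next
    case False
    then show ?thesis
      using jacobiP_orthogonal_less[of n n' a] assms by (simp add: mult.commute)
  qed
  moreover have "t powr a * (jacobiPhat n a 0 (1 - 2 * t) * jacobiPhat n' a 0 (1 - 2 * t))
      = (jacobiA n a 0 * jacobiA n' a 0) * (t powr a * (jacobiP n a 0 (1 - 2 * t) * jacobiP n' a 0 (1 - 2 * t)))" for t
    by (simp add: jacobiPhat_def)
  ultimately show ?thesis by (simp only: interval_lebesgue_integral_mult_right mult_zero_right)
qed

text \<open>Substitute \<open>u = 1 - 2 * t\<close>: the weight yields \<open>2 powr a\<close> and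
  the differential another 2. On the open interval \<open>1 + u > 0\<close>, so
  \<open>(1 + u) powr 0\<close> is 1; at \<open>u = -1\<close> it would be 0.\<close>

lemma jacobi_hhat_unit_interval:
  "jacobi_hhat n a 0 = 2 powr (a + 1) * (LBINT t=0..1. t powr a * (jacobiPhat n a 0 (1 - 2 * t))\<^sup>2)"
proof -
  let ?f = "\<lambda>u. (jacobiPhat n a 0 u)\<^sup>2 * (1 - u) powr a * (1 + u) powr 0"
  have "jacobi_hhat n a 0 = integral\<^sup>L lborel (\<lambda>u. indicator (einterval (-1) 1) u *\<^sub>R ?f u)"
    unfolding jacobi_hhat_def
    by (subst interval_lebesgue_integral_le_eq) (auto simp: one_ereal_def set_lebesgue_integral_def)
  also have "\<dots> = 2 *\<^sub>R integral\<^sup>L lborel (\<lambda>t. indicator (einterval (-1) 1) (1 + (-2) * t) *\<^sub>R ?f (1 + (-2) * t))"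
    by (subst lborel_integral_real_affine[where c = "-2" and t = 1]) auto
  also have "(\<lambda>t. indicator (einterval (-1) 1) (1 + (-2) * t) *\<^sub>R ?f (1 + (-2) * t))
      = (\<lambda>t. indicator (einterval 0 1) t *\<^sub>R (2 powr a * (t powr a * (jacobiPhat n a 0 (1 - 2 * t))\<^sup>2)))"
  proof
    fix t :: real
    have "1 + (-2) * t \<in> einterval (-1) 1 \<longleftrightarrow> t \<in> einterval 0 1"
      by (auto simp: einterval_def zero_ereal_def one_ereal_def)
    moreover have "t > 0 \<and> t < 1" if "t \<in> einterval 0 1"
      using that by (auto simp: einterval_def zero_ereal_def one_ereal_def)
    ultimately show "indicator (einterval (-1) 1) (1 + (-2) * t) *\<^sub>R ?f (1 + (-2) * t)
      = indicator (einterval 0 1) t *\<^sub>R (2 powr a * (t powr a * (jacobiPhat n a 0 (1 - 2 * t))\<^sup>2))"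
      by (cases "t \<in> einterval 0 1") (auto simp: powr_mult)
  qed
  also have "integral\<^sup>L lborel \<dots> = 2 powr a * (LBINT t=0..1. t powr a * (jacobiPhat n a 0 (1 - 2 * t))\<^sup>2)"
    by (simp only: interval_integral_unit_interval[symmetric] interval_lebesgue_integral_mult_right)
  finally show ?thesis by (simp add: powr_add)
qed

section \<open>Iterated antiderivatives and the polynomials \<open>jacobiJ\<close>\<close>

lemma poly_antiderivative:
  fixes q :: "real poly"
  obtains R where "pderiv R = q" "poly R a = 0"
proof -
  define S where "S = (\<Sum>i\<le>degree q. monom (coeff q i / real (Suc i)) (Suc i))"
  have "pderiv S = (\<Sum>i\<le>degree q. monom (coeff q i) i)"
    unfolding S_def higher_pderiv_sum[of 1, simplified] by (simp add: pderiv_monom del: of_nat_Suc)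
  then have S: "pderiv S = q" by (simp add: poly_as_sum_of_monoms)
  show thesis by (rule that[of "S - [:poly S a:]"]) (simp_all add: S pderiv_diff)
qed

text \<open>Cauchy's formula for \<open>k + 1\<close> repeated integrations from \<open>a\<close>.
  The induction applies the formula for \<open>k\<close> to an antiderivative of \<open>q\<close>
  and integrates by parts.\<close>

lemma poly_iterated_integral:
  fixes q :: "real poly"
  shows "\<exists>Q. (pderiv ^^ Suc k) Q = q \<and> (\<forall>i\<le>k. poly ((pderiv ^^ i) Q) a = 0)
    \<and> (\<forall>u. (LBINT w=a..u. (u - w) ^ k / fact k * poly q w) = poly Q u)"
proof (induction k arbitrary: q)
  case 0
  obtain R where R: "pderiv R = q" "poly R a = 0" by (rule poly_antiderivative)
  have "(LBINT w=a..u. poly q w) = poly R u" for u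
  proof -
    have "(poly R has_vector_derivative poly q w) (at w within S)" for w S
      using poly_DERIV[of R w] R(1)
      by (simp add: has_field_derivative_at_within flip: has_real_derivative_iff_has_vector_derivative)
    then have "(LBINT w=a..u. poly q w) = poly R u - poly R a"
      by (intro interval_integral_FTC_finite) (auto intro!: continuous_intros)
    then show ?thesis using R(2) by simp
  qed
  then show ?case using R by (intro exI[of _ R]) auto
next
  case (Suc k)
  obtain R where R: "pderiv R = q" "poly R a = 0" by (rule poly_antiderivative)
  obtain Q where Q: "(pderiv ^^ Suc k) Q = R" "\<forall>i\<le>k. poly ((pderiv ^^ i) Q) a = 0"
    "\<And>u. (LBINT w=a..u. (u - w) ^ k / fact k * poly R w) = poly Q u" using Suc.IH[of R] by blast
  have "(LBINT w=a..u. (u - w) ^ Suc k / fact (Suc k) * poly q w) = poly Q u" for u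
  proof -
    let ?A = "\<lambda>w. (u - w) ^ Suc k / fact (Suc k) * poly q w"
    let ?B = "\<lambda>w. (u - w) ^ k / fact k * poly R w"
    \<comment> \<open>The boundary term of the integration by parts: it vanishes at
      \<open>w = u\<close> through the power and at \<open>w = a\<close> through
      \<open>R\<close>.\<close>
    let ?F = "\<lambda>w. (u - w) ^ Suc k / fact (Suc k) * poly R w"
    have D: "(?F has_real_derivative ?A w - ?B w) (at w)" for w
    proof -
      have "((\<lambda>w. (u - w) ^ Suc k / fact (Suc k)) has_real_derivative - ((u - w) ^ k / fact k)) (at w)"
        by (auto intro!: derivative_eq_intros simp: divide_simps simp del: of_nat_Suc power_Suc)
      from DERIV_mult[OF this poly_DERIV[of R w]] show ?thesis by (simp add: R mult_ac)
    qed
    have "(?F has_vector_derivative ?A w - ?B w) (at w within S)" for w S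
      by (rule has_vector_derivative_at_within)
        (rule D[unfolded has_real_derivative_iff_has_vector_derivative])
    then have "(LBINT w=a..u. ?A w - ?B w) = ?F u - ?F a"
      by (intro interval_integral_FTC_finite) (auto intro!: continuous_intros)
    moreover have "(LBINT w=a..u. ?A w - ?B w) = (LBINT w=a..u. ?A w) - (LBINT w=a..u. ?B w)"
      by (intro interval_lebesgue_integral_diff interval_integrable_isCont continuous_intros) auto
    ultimately show ?thesis using R Q(3) by simp
  qed
  moreover have "poly ((pderiv ^^ i) Q) a = 0" if "i \<le> Suc k" for i
    using that Q R by (cases "i = Suc k") auto
  ultimately show ?case using Q(1) R(1) by (intro exI[of _ Q]) auto
qed

lemma pderiv_shifted_power:
  "(pderiv ^^ k) (smult (1 / fact n) ([:1, 1::real:] ^ n))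
    = (if k \<le> n then smult (1 / fact (n - k)) ([:1, 1:] ^ (n - k)) else 0)"
proof (induction k)
  case (Suc k)
  have "pderiv (smult (1 / fact (Suc i)) ([:1, 1::real:] ^ Suc i)) = smult (1 / fact i) ([:1, 1:] ^ i)" for i
    by (simp only: pderiv_smult pderiv_power_Suc) (simp add: pderiv_pCons divide_simps del: power_Suc of_nat_Suc)
  from this[of "n - Suc k"] show ?case using Suc
    by (cases "k < n") (auto simp: Suc_diff_Suc pderiv_smult simp del: power_Suc fact_Suc)
qed simp

lemma jacobiPhat_poly: "\<exists>q. \<forall>u. jacobiPhat n a b u = poly q u"
proof
  show "\<forall>u. jacobiPhat n a b u = poly (smult (jacobiA n a b) (\<Sum>k=0..n. smult
      (pochhammer (a + real k + 1) (n - k) * pochhammer (- real n) k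
       * pochhammer (real n + a + b + 1) k / (fact n * fact k)) ([:1/2, -1/2:] ^ k))) u"
    by (simp add: jacobiPhat_def jacobiP_def poly_sum diff_divide_distrib)
qed

text \<open>These are the Taylor monomials at \<open>-1\<close>: each derivative lowers the exponent
  by one, and only the \<open>n\<close>-th is nonzero at \<open>-1\<close>.\<close>

lemma jacobiJ_poly_small:
  assumes "s \<ge> 1" "n < s"
  obtains Q where "\<And>u. jacobiJ n a s u = poly Q u" "(pderiv ^^ s) Q = 0"
    "\<And>k. poly ((pderiv ^^ k) Q) (-1) = (if k = n then 1 else 0)"
proof
  let ?Q = "smult (1 / fact n) ([:1, 1::real:] ^ n)"
  show "jacobiJ n a s u = poly ?Q u" for u
    using assms by (auto simp: jacobiJ_def add.commute)
  show "(pderiv ^^ s) ?Q = 0" using assms by (simp add: pderiv_shifted_power)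
  show "poly ((pderiv ^^ k) ?Q) (-1) = (if k = n then 1 else 0)" for k
    by (auto simp: pderiv_shifted_power)
qed

text \<open>Cauchy's formula with \<open>k = s - 1\<close> exhibits \<open>jacobiJ\<close> as the
  \<open>s\<close>-fold antiderivative from \<open>-1\<close> of a
  \<open>jacobiPhat\<close>.\<close>

lemma jacobiJ_poly_large:
  assumes "s \<ge> 1" "n \<ge> s"
  obtains Q where "\<And>u. jacobiJ n a s u = poly Q u"
    "\<And>u. poly ((pderiv ^^ s) Q) u = jacobiPhat (n - s) (a + real s) 0 u"
    "\<And>k. k < s \<Longrightarrow> poly ((pderiv ^^ k) Q) (-1) = 0"
proof -
  obtain q where q: "\<And>u. jacobiPhat (n - s) (a + real s) 0 u = poly q u" using jacobiPhat_poly by blast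
  obtain Q where Q: "(pderiv ^^ Suc (s - 1)) Q = q" "\<forall>i\<le>s - 1. poly ((pderiv ^^ i) Q) (-1) = 0"
     "\<And>u. (LBINT w=ereal (-1)..u. (u - w) ^ (s - 1) / fact (s - 1) * poly q w) = poly Q u"
    using poly_iterated_integral[of "s - 1" q "-1"] by blast
  show thesis
  proof (rule that[of Q])
    show "jacobiJ n a s u = poly Q u" for u
    proof -
      \<comment> \<open>The case split of \<open>jacobiJ\<close> uses truncated subtraction;
        \<open>s \<ge> 1\<close> makes \<open>n \<le> s - 1\<close> the same as
        \<open>n < s\<close>.\<close>
      have "\<not> n \<le> s - 1" using assms by linarith
      then show ?thesis using Q(3)[of u] by (simp add: jacobiJ_def q one_ereal_def)
    qed
    show "poly ((pderiv ^^ s) Q) u = jacobiPhat (n - s) (a + real s) 0 u" for u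
      using Q(1) assms by (simp add: q del: funpow.simps)
    show "poly ((pderiv ^^ k) Q) (-1) = 0" if "k < s" for k using Q(2) that by simp
  qed
qed

section \<open>The Sobolev inner product\<close>

text \<open>Each \<open>t\<close>-derivative of a polynomial in \<open>1 - 2 * t\<close> brings a
  factor \<open>-2\<close>, while \<open>Y x\<close> is constant because \<open>x\<close> is held
  fixed.\<close>

lemma dt_sobS:
  assumes "\<And>u. jacobiJ (n - m) (2 * real m + \<beta> + real CARD('d) - 1) s u = poly Q u"
  shows "dt k (sobS \<beta> s n m Y) (x :: real^'d::finite) t = (-2) ^ k * poly ((pderiv ^^ k) Q) (1 - 2 * t) * Y x"
proof -
  have "(deriv ^^ k) (\<lambda>\<tau>. poly Q (1 - 2 * \<tau>) * Y x) = (\<lambda>t. (-2) ^ k * poly ((pderiv ^^ k) Q) (1 - 2 * t) * Y x)"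
  proof (induction k)
    case (Suc k)
    have "((\<lambda>t. (-2) ^ k * poly ((pderiv ^^ k) Q) (1 - 2 * t) * Y x) has_real_derivative
        (-2) ^ Suc k * poly ((pderiv ^^ Suc k) Q) (1 - 2 * t) * Y x) (at t)" for t
      by (auto intro!: derivative_eq_intros DERIV_chain2[OF poly_DERIV])
    then have "deriv (\<lambda>t. (-2) ^ k * poly ((pderiv ^^ k) Q) (1 - 2 * t) * Y x)
        = (\<lambda>t. (-2) ^ Suc k * poly ((pderiv ^^ Suc k) Q) (1 - 2 * t) * Y x)"
      by (intro ext DERIV_imp_deriv)
    then show ?case by (simp only: funpow.simps comp_apply Suc)
  qed simp
  then show ?thesis by (simp add: dt_def sobS_def assms)
qed

text \<open>Homogeneity pulls \<open>t ^ m * t ^ m'\<close> out of the spherical integral, which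
  becomes a common factor of all terms. The factors \<open>-2\<close> pair up to powers of 4, and
  the boundary \<open>t = 1\<close> corresponds to the argument \<open>-1\<close>.\<close>

lemma sob_ip_sobS:
  fixes Y Z :: "real^'d::finite \<Rightarrow> real"
  assumes Y: "Y \<in> sph_harm m" and Z: "Z \<in> sph_harm m'"
    and Q: "\<And>u. jacobiJ (n - m) (2 * real m + \<beta> + real CARD('d) - 1) s u = poly Q u"
    and Q': "\<And>u. jacobiJ (n' - m') (2 * real m' + \<beta> + real CARD('d) - 1) s u = poly Q' u"
  shows "sob_ip \<beta> s lam (sobS \<beta> s n m Y) (sobS \<beta> s n' m' Z)
    = (1 / omega CARD('d) * sph_int (\<lambda>\<xi>. Y \<xi> * Z \<xi>)) *
      (4 ^ s * (LBINT t=0..1. t powr (real m + real m' + \<beta> + real s + real CARD('d) - 1) *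
          (poly ((pderiv ^^ s) Q) (1 - 2 * t) * poly ((pderiv ^^ s) Q') (1 - 2 * t)))
       + (\<Sum>k<s. lam k * 4 ^ k * (poly ((pderiv ^^ k) Q) (-1) * poly ((pderiv ^^ k) Q') (-1))))"
proof -
  let ?I = "sph_int (\<lambda>\<xi>. Y \<xi> * Z \<xi>)"
  have hY: "Y (t *\<^sub>R x) = t ^ m * Y x" and hZ: "Z (t *\<^sub>R x) = t ^ m' * Z x" for t x
    using Y Z by (auto simp: sph_harm_def)
  have pull: "sph_int (\<lambda>\<xi>. c * (Y \<xi> * Z \<xi>)) = c * ?I" for c by (simp add: sph_int_def)
  have four: "(-2) ^ k * (-2) ^ k = (4::real) ^ k" for k by (simp flip: power_mult_distrib)
  have pt: "sph_int (\<lambda>\<xi>. dt k (sobS \<beta> s n m Y) \<xi> 1 * dt k (sobS \<beta> s n' m' Z) \<xi> 1)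
      = 4 ^ k * (poly ((pderiv ^^ k) Q) (-1) * poly ((pderiv ^^ k) Q') (-1)) * ?I" for k
    unfolding dt_sobS[OF Q] dt_sobS[OF Q'] pull[symmetric] four[symmetric] by (simp add: mult_ac)
  have "cone_int (\<lambda>x t. dt s (sobS \<beta> s n m Y) x t * dt s (sobS \<beta> s n' m' Z) x t * t powr (\<beta> + real s))
     = (LBINT t=0..1. 4 ^ s * ?I * (t powr (real m + real m' + \<beta> + real s + real CARD('d) - 1) *
          (poly ((pderiv ^^ s) Q) (1 - 2 * t) * poly ((pderiv ^^ s) Q') (1 - 2 * t))))"
    unfolding cone_int_def
  proof (rule interval_integral_cong)
    \<comment> \<open>Agreement on the open interval suffices; there \<open>t > 0\<close>, so all
      powers of \<open>t\<close>, including the surface factor \<open>t ^ (d - 1)\<close>, merge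
      into one \<open>powr\<close>.\<close>
    fix t :: real assume "t \<in> einterval (min 0 1) (max 0 1)"
    then have t: "t > 0" by (auto simp: einterval_def)
    let ?p = "poly ((pderiv ^^ s) Q) (1 - 2 * t) * poly ((pderiv ^^ s) Q') (1 - 2 * t)"
    have "sph_int (\<lambda>\<xi>. dt s (sobS \<beta> s n m Y) (t *\<^sub>R \<xi>) t * dt s (sobS \<beta> s n' m' Z) (t *\<^sub>R \<xi>) t * t powr (\<beta> + real s))
      = 4 ^ s * ?p * t ^ m * t ^ m' * t powr (\<beta> + real s) * ?I"
      unfolding dt_sobS[OF Q] dt_sobS[OF Q'] pull[symmetric] four[symmetric] hY hZ by (simp add: mult_ac)
    moreover have "t powr (real m + real m' + \<beta> + real s + real CARD('d) - 1)
        = t ^ m * t ^ m' * t powr (\<beta> + real s) * t ^ (CARD('d) - 1)"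
    proof -
      have "real m + real m' + \<beta> + real s + real CARD('d) - 1
          = real m + real m' + (\<beta> + real s) + real (CARD('d) - 1)" by (simp add: of_nat_diff)
      then show ?thesis using t by (simp only: powr_add powr_realpow)
    qed
    ultimately show "t ^ (CARD('d) - 1) * sph_int (\<lambda>\<xi>. dt s (sobS \<beta> s n m Y) (t *\<^sub>R \<xi>) t *
        dt s (sobS \<beta> s n' m' Z) (t *\<^sub>R \<xi>) t * t powr (\<beta> + real s))
      = 4 ^ s * ?I * (t powr (real m + real m' + \<beta> + real s + real CARD('d) - 1) * ?p)"
      by (simp only: mult_ac)
  qed
  then show ?thesis
    unfolding sob_ip_def pt by (simp add: distrib_left sum_distrib_left mult_ac)
qed

theorem mainTheorem2:
  fixes \<beta> :: real and s :: nat and lam :: "nat \<Rightarrow> real"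
    and Y :: "nat \<Rightarrow> nat \<Rightarrow> (real^'d::finite \<Rightarrow> real)" and N :: "nat \<Rightarrow> nat"
  assumes "CARD('d) \<ge> 2"
    and "s \<ge> 1"
    and "\<beta> > - real CARD('d) - real s"
    and "\<forall>k<s. lam k > 0"
    and "\<forall>m. \<forall>l\<in>{1..N m}. Y m l \<in> sph_harm m"
    and "\<forall>m. \<forall>l\<in>{1..N m}. \<forall>l'\<in>{1..N m}.
           1 / omega CARD('d) * sph_int (\<lambda>\<xi>. Y m l \<xi> * Y m l' \<xi>) = (if l = l' then 1 else 0)"
    and "\<forall>m. \<forall>f\<in>sph_harm m. \<exists>c. \<forall>x. f x = (\<Sum>l=1..N m. c l * Y m l x)"
  shows "(\<forall>n m l n' m' l'. m \<le> n \<longrightarrow> m' \<le> n' \<longrightarrow> l \<in> {1..N m} \<longrightarrow> l' \<in> {1..N m'}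
            \<longrightarrow> (n, m, l) \<noteq> (n', m', l')
            \<longrightarrow> sob_ip \<beta> s lam (sobS \<beta> s n m (Y m l)) (sobS \<beta> s n' m' (Y m' l')) = 0)
       \<and> (\<forall>n m l. m \<le> n \<longrightarrow> l \<in> {1..N m} \<longrightarrow>
            sob_ip \<beta> s lam (sobS \<beta> s n m (Y m l)) (sobS \<beta> s n m (Y m l)) =
              (if n - m \<le> s - 1 then 2 ^ (2 * (n - m)) * lam (n - m)
               else 2 powr (real s - \<beta> - 2 * real m - real CARD('d))
                    * jacobi_hhat (n - m - s) (real s + 2 * real m + \<beta> + real CARD('d) - 1) 0))"
proof -
  let ?d = "real CARD('d)"
  \<comment> \<open>For \<open>m = m'\<close> this is both the exponent of the radial weight and the
    first parameter of the Jacobi polynomial produced by the \<open>s\<close>-th derivative; this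
    agreement makes the bracket diagonal.\<close>
  define \<alpha> where "\<alpha> = (\<lambda>m. real s + 2 * real m + \<beta> + ?d - 1)"
  define bracket where "bracket = (\<lambda>m Q Q'.
    4 ^ s * (LBINT t=0..1. t powr \<alpha> m * (poly ((pderiv ^^ s) Q) (1 - 2 * t) * poly ((pderiv ^^ s) Q') (1 - 2 * t)))
    + (\<Sum>k<s. lam k * 4 ^ k * (poly ((pderiv ^^ k) Q) (-1) * poly ((pderiv ^^ k) Q') (-1))))"
  \<comment> \<open>A polynomial is determined by its values, so this chosen representative agrees
    with the polynomials of both cases of \<open>jacobiJ\<close>.\<close>
  define J where "J = (\<lambda>m n. SOME Q. \<forall>u. jacobiJ (n - m) (2 * real m + \<beta> + ?d - 1) s u = poly Q u)"
  \<comment> \<open>For \<open>m = 0\<close> this is exactly the hypothesis on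
    \<open>\<beta>\<close>; larger \<open>m\<close> only increase \<open>\<alpha> m\<close>.\<close>
  have \<alpha>: "\<alpha> m > -1" for m using assms(3) by (simp add: \<alpha>_def)
  have J: "jacobiJ (n - m) (2 * real m + \<beta> + ?d - 1) s u = poly (J m n) u" for m n u
  proof -
    have "\<exists>Q. \<forall>u. jacobiJ (n - m) (2 * real m + \<beta> + ?d - 1) s u = poly Q u"
      using jacobiJ_poly_small[OF assms(2), of "n - m"] jacobiJ_poly_large[OF assms(2), of "n - m"]
      by (metis not_less)
    from someI_ex[OF this] show ?thesis unfolding J_def by blast
  qed
  have J_unique: "J m n = Q" if "\<And>u. jacobiJ (n - m) (2 * real m + \<beta> + ?d - 1) s u = poly Q u" for m n Q
    using that J[of n m] by (metis poly_eq_poly_eq_iff ext)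
  have small: "(pderiv ^^ s) (J m n) = 0"
    "poly ((pderiv ^^ k) (J m n)) (-1) = (if k = n - m then 1 else 0)" if "n - m < s" for m n k
    using jacobiJ_poly_small[OF assms(2) that, of "2 * real m + \<beta> + ?d - 1"] J_unique by metis+
  have large: "poly ((pderiv ^^ s) (J m n)) u = jacobiPhat (n - m - s) (\<alpha> m) 0 u"
    "k < s \<Longrightarrow> poly ((pderiv ^^ k) (J m n)) (-1) = 0" if nm: "s \<le> n - m" for m n k u
  proof -
    have a: "2 * real m + \<beta> + ?d - 1 + real s = \<alpha> m" by (simp add: \<alpha>_def)
    obtain Q where Q: "\<And>u. jacobiJ (n - m) (2 * real m + \<beta> + ?d - 1) s u = poly Q u"
      "\<And>u. poly ((pderiv ^^ s) Q) u = jacobiPhat (n - m - s) (\<alpha> m) 0 u"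
      "\<And>k. k < s \<Longrightarrow> poly ((pderiv ^^ k) Q) (-1) = 0"
      using jacobiJ_poly_large[OF assms(2) nm, of "2 * real m + \<beta> + ?d - 1"] unfolding a by blast
    have "J m n = Q" by (rule J_unique[OF Q(1)])
    with Q show "poly ((pderiv ^^ s) (J m n)) u = jacobiPhat (n - m - s) (\<alpha> m) 0 u"
      "k < s \<Longrightarrow> poly ((pderiv ^^ k) (J m n)) (-1) = 0" by auto
  qed
  have same: "sob_ip \<beta> s lam (sobS \<beta> s n m (Y m l)) (sobS \<beta> s n' m (Y m l'))
      = (if l = l' then bracket m (J m n) (J m n') else 0)"
    if "l \<in> {1..N m}" "l' \<in> {1..N m}" for n n' m l l'
  proof -
    have "real m + real m + \<beta> + real s + ?d - 1 = \<alpha> m" by (simp add: \<alpha>_def)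
    moreover have "1 / omega CARD('d) * sph_int (\<lambda>\<xi>. Y m l \<xi> * Y m l' \<xi>) = (if l = l' then 1 else 0)"
      using assms(6) that by blast
    ultimately show ?thesis
      using sob_ip_sobS[of "Y m l" m "Y m l'" m n \<beta> s "J m n" n' "J m n'" lam] assms(5) that J
      by (simp add: bracket_def)
  qed
  have different: "sob_ip \<beta> s lam (sobS \<beta> s n m (Y m l)) (sobS \<beta> s n' m' (Y m' l')) = 0"
    if "m \<noteq> m'" "l \<in> {1..N m}" "l' \<in> {1..N m'}" for n n' m m' l l'
    using sob_ip_sobS[of "Y m l" m "Y m' l'" m' n \<beta> s "J m n" n' "J m' n'" lam] assms(5) that J
      sph_harm_orthogonal[OF assms(1), of "Y m l" m "Y m' l'" m'] by simp
  have bracket_neq: "bracket m (J m n) (J m n') = 0" if "m \<le> n" "m \<le> n'" "n \<noteq> n'" for m n n'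
  \<comment> \<open>If one difference is below \<open>s\<close>, its \<open>s\<close>-th derivative
    kills the integral and the boundary values at \<open>-1\<close> never overlap, since
    \<open>m \<le> n\<close> and \<open>m \<le> n'\<close> keep the differences distinct. Otherwise
    all boundary values vanish and Jacobi orthogonality applies.\<close>
  proof (cases "n - m < s \<or> n' - m < s")
    case True
    have "n - m \<noteq> n' - m" using that by linarith
    then have "poly ((pderiv ^^ k) (J m n)) (-1) * poly ((pderiv ^^ k) (J m n')) (-1) = 0" if "k < s" for k
      using that True small(2)[of n m k] small(2)[of n' m k] large(2)[of n m k] large(2)[of n' m k]
      by (metis linorder_not_less mult_eq_0_iff)
    then have "(\<Sum>k<s. lam k * 4 ^ k * (poly ((pderiv ^^ k) (J m n)) (-1) * poly ((pderiv ^^ k) (J m n')) (-1))) = 0"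
      by (intro sum.neutral) simp
    moreover have "(pderiv ^^ s) (J m n) = 0 \<or> (pderiv ^^ s) (J m n') = 0"
      using True small(1) by blast
    ultimately show ?thesis unfolding bracket_def by auto
  next
    case False
    then have "s \<le> n - m" "s \<le> n' - m" "n - m - s \<noteq> n' - m - s" using that by linarith+
    then show ?thesis using jacobiPhat_orthogonal[OF _ \<alpha>[of m], of "n - m - s" "n' - m - s"]
      by (simp add: bracket_def large)
  qed
  have bracket_eq: "bracket m (J m n) (J m n) = (if n - m \<le> s - 1 then 2 ^ (2 * (n - m)) * lam (n - m)
      else 2 powr (real s - \<beta> - 2 * real m - ?d) * jacobi_hhat (n - m - s) (\<alpha> m) 0)" for m n
  proof (cases "n - m < s")
    case True
    then have "n - m \<le> s - 1" by linarith
    moreover have "(\<Sum>k<s. lam k * 4 ^ k * (poly ((pderiv ^^ k) (J m n)) (-1) * poly ((pderiv ^^ k) (J m n)) (-1)))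
        = (\<Sum>k<s. if k = n - m then lam k * 4 ^ k else 0)"
      using True by (intro sum.cong) (auto simp: small)
    ultimately show ?thesis using True by (simp add: bracket_def small power_mult)
  next
    case False
    then have "\<not> n - m \<le> s - 1" "s \<le> n - m" using assms(2) by linarith+
    \<comment> \<open>The factor \<open>2 powr (\<alpha> m + 1)\<close> is the substitution constant
      that converts the integral on the unit interval into \<open>jacobi_hhat\<close>; the remaining
      exponent is \<open>2 s - (\<alpha> m + 1)\<close>.\<close>
    moreover have "(4::real) ^ s = 2 powr (real s - \<beta> - 2 * real m - ?d) * 2 powr (\<alpha> m + 1)"
    proof -
      have "2 powr (2 * real s) = (2 powr 2) powr real s" by (simp only: powr_powr)
      then have "(4::real) ^ s = 2 powr (2 * real s)" by (simp add: powr_realpow)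
      then show ?thesis by (simp add: \<alpha>_def flip: powr_add)
    qed
    ultimately show ?thesis
      by (simp add: bracket_def large jacobi_hhat_unit_interval power2_eq_square)
  qed
  show ?thesis
  proof (intro conjI allI impI)
    fix n m l n' m' l'
    assume "m \<le> n" "m' \<le> n'" "l \<in> {1..N m}" "l' \<in> {1..N m'}" "(n, m, l) \<noteq> (n', m', l')"
    \<comment> \<open>Different \<open>m\<close> are separated by the spherical integral. For equal
      \<open>m\<close>, either \<open>l \<noteq> l'\<close> and orthonormality of the basis applies,
      or \<open>n \<noteq> n'\<close> and the bracket vanishes.\<close>
    then show "sob_ip \<beta> s lam (sobS \<beta> s n m (Y m l)) (sobS \<beta> s n' m' (Y m' l')) = 0"
      by (cases "m = m'") (auto simp: different same bracket_neq)
  next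
    fix n m l
    assume "m \<le> n" "l \<in> {1..N m}"
    then show "sob_ip \<beta> s lam (sobS \<beta> s n m (Y m l)) (sobS \<beta> s n m (Y m l)) =
      (if n - m \<le> s - 1 then 2 ^ (2 * (n - m)) * lam (n - m)
       else 2 powr (real s - \<beta> - 2 * real m - ?d)
         * jacobi_hhat (n - m - s) (real s + 2 * real m + \<beta> + ?d - 1) 0)"
      by (simp only: same bracket_eq \<alpha>_def simp_thms if_True)
  qed
qed

end
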